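(* Let $X$ be a birth and death process on $\mathbb{N}$ absorbed at $0$, with birth rates $(b_i)_{i\ge 0}$ and death rates $(d_i)_{i\ge 0}$ satisfying $b_0=d_0=0$, $b_i>0$ and $d_i>0$ for all $i\ge 1$, and $\sum_{n=1}^{\infty}\frac{d_1d_2\cdots d_n}{b_1b_2\cdots b_n}=+\infty$, and let $\mathcal{L}$ be its infinitesimal generator. Assume that $X$ is $\xi_1$-positive recurrent. Then the domain of attraction of the minimal quasi-stationary distribution of $X$ contains the set $$\mathcal{D}=\Big\{\mu\in\mathcal{M}_1(\mathbb{N}^* ):\ \sum_{i=1}^{\infty}\mu_i\,Q_i(\xi_1)<+\infty\Big\}.$$ Assume moreover that there exist $C>0$, $\lambda_1>\xi_1$ and $\phi:\mathbb{N}\to\mathbb{R}_+$ such that $\phi(i)\to\infty$ when $i\to\infty$ and $$\mathcal{L}\phi(i)\le-\lambda_1\phi(i)+C,\quad\forall i\ge1.$$ Then the domain of attraction of the minimal quasi-stationary distribution of $X$ contains the set $$\mathcal{D}_\phi=\Big\{\mu\in\mathcal{M}_1(\mathbb{N}^* ):\ \sum_{i=1}^{\infty}\mu_i\,\phi(i)<+\infty\Big\}.$$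
   Context: $\mathbb{N}=\{0,1,2,\ldots\}$, $\mathbb{N}^*=\{1,2,\ldots\}$, $\mathbb{R}_+=[0,\infty)$; $\mathcal{M}_1(\mathbb{N}^* )$ is the set of probability measures on $\mathbb{N}^*$, and $\mu_i=\mu(\{i\})$. The birth and death process $X=(X_t)_{t\ge0}$ with rates $(b_i),(d_i)$ is the $\mathbb{N}$-valued continuous-time pure jump Markov process which jumps from $i\ge1$ to $i+1$ at rate $b_i$, to $i-1$ at rate $d_i$, and to any other state at rate $0$; the state $0$ is absorbing. Under the condition $\sum_{n\ge1}\frac{d_1\cdots d_n}{b_1\cdots b_n}=+\infty$, the process is non-explosive and $T_0=\inf\{t\ge0: X_t=0\}$ is finite almost surely for every initial law. $\mathbb{P}_\mu$ denotes the law of $X$ with initial distribution $\mu$, and $\mathbb{P}_x=\mathbb{P}_{\delta_x}$. Generator: for any function $\phi$ on $\mathbb{N}$ and $i\ge1$, $\mathcal{L}\phi(i)=b_i(\phi(i+1)-\phi(i))+d_i(\phi(i-1)-\phi(i))$, and $\mathcal{L}\phi(0)=0$. Quasi-stationary distribution: a probability measure $\rho$ on $\mathbb{N}^*$ such that $\mathbb{P}_\rho(X_t\in\cdot\mid t<T_0)=\rho(\cdot)$ for all $t\ge0$. The domain of attraction of a quasi-stationary distribution $\rho$ is the set of $\mu\in\mathcal{M}_1(\mathbb{N}^* )$ such that $\lim_{t\to\infty}\mathbb{P}_\mu(X_t\in\cdot\mid t<T_0)=\rho(\cdot)$ (weak convergence on the discrete space $\mathbb{N}^*$, i.e. $\mathbb{P}_\mu(X_t=j\mid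 t<T_0)\to\rho(j)$ for every $j\ge1$). The minimal quasi-stationary distribution (Yaglom limit) is the unique quasi-stationary distribution whose domain of attraction contains $\delta_x$ for every $x\in\mathbb{N}^*$. Polynomials $Q_n$ and the number $\xi_1$: for $x\in\mathbb{R}$, $Q_1(x)=1$, $b_1Q_2(x)=b_1+d_1-x$, and $b_nQ_{n+1}(x)=(b_n+d_n-x)Q_n(x)-d_nQ_{n-1}(x)$ for $n\ge2$. The number $\xi_1\ge0$ is the unique non-negative number such that, for real $x$, $x\le\xi_1$ if and only if $Q_n(x)>0$ for all $n\ge1$ (it is known that such a number exists and is unique). It is known (van Doorn) that the minimal quasi-stationary distribution exists when $\xi_1>0$. $X$ is said to be $\xi_1$-positive recurrent if $\xi_1>0$ and, for some $i\ge1$ (and hence for all $i\ge1$), $\lim_{t\to\infty}e^{\xi_1t}\,\mathbb{P}_i(X_t=i)>0$. *)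

theory Defs
  imports "HOL-Probability.Probability"
begin

definition bd_rate :: "(nat \<Rightarrow> real) \<Rightarrow> (nat \<Rightarrow> real) \<Rightarrow> nat \<Rightarrow> nat \<Rightarrow> real" where
  "bd_rate b d i j =
     (if j = i + 1 then b i
      else if j + 1 = i then d i
      else if j = i then - (b i + d i)
      else 0)"

text \<open>
  The process \<open>X\<close> lives on one measurable space, which carries the law \<open>P i\<close> of the process
  started at \<open>i\<close>, for every state \<open>i\<close>. Only times \<open>t \<ge> 0\<close> matter. In the discrete space
  \<^typ>\<open>nat\<close>, right-continuous paths with left limits are exactly the step functions with
  finitely many jumps on bounded time intervals. The Markov property is stated for the natural
  filtration of \<open>X\<close>, and the jump rates are the derivatives at \<open>0\<close> of the transition
  probabilities (the diagonal one says that the total jump rate from \<open>i\<close> is \<open>b i + d i\<close>).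
  With \<open>b 0 = d 0 = 0\<close> all rates out of \<open>0\<close> vanish, so that \<open>0\<close> is absorbing.
\<close>

locale birth_death_process =
  fixes b d :: "nat \<Rightarrow> real"
    and P :: "nat \<Rightarrow> 'w measure"
    and X :: "real \<Rightarrow> 'w \<Rightarrow> nat"
  assumes prob_space_P: "prob_space (P i)"
    and sets_P: "sets (P i) = sets (P j)"
    and measurable_X: "0 \<le> t \<Longrightarrow> X t \<in> P i \<rightarrow>\<^sub>M count_space UNIV"
    and right_continuous:
      "0 \<le> t \<Longrightarrow> \<omega> \<in> space (P i) \<Longrightarrow> ((\<lambda>s. X s \<omega>) \<longlongrightarrow> X t \<omega>) (at_right t)"
    and left_limit:
      "0 < t \<Longrightarrow> \<omega> \<in> space (P i) \<Longrightarrow> \<exists>l. ((\<lambda>s. X s \<omega>) \<longlongrightarrow> l) (at_left t)"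
    and start: "\<P>(\<omega> in P i. X 0 \<omega> = i) = 1"
    and markov:
      "0 \<le> s \<Longrightarrow> 0 \<le> h \<Longrightarrow>
       A \<in> sigma_sets (space (P i)) {X u -` {l} \<inter> space (P i) | u l. 0 \<le> u \<and> u \<le> s} \<Longrightarrow>
       \<P>(\<omega> in P i. \<omega> \<in> A \<and> X s \<omega> = k \<and> X (s + h) \<omega> = j)
         = \<P>(\<omega> in P i. \<omega> \<in> A \<and> X s \<omega> = k) * \<P>(\<omega> in P k. X h \<omega> = j)"
    and rates:
      "((\<lambda>h. \<P>(\<omega> in P i. X h \<omega> = j)) has_real_derivative bd_rate b d i j) (at 0 within {0..})"

definition bd_generator ::
  "(nat \<Rightarrow> real) \<Rightarrow> (nat \<Rightarrow> real) \<Rightarrow> (nat \<Rightarrow> real) \<Rightarrow> nat \<Rightarrow> real" where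
  "bd_generator b d \<phi> i =
     (if i = 0 then 0
      else b i * (\<phi> (i + 1) - \<phi> i) + d i * (\<phi> (i - 1) - \<phi> i))"

text \<open>Probability measures on the positive integers, as distributions on \<^typ>\<open>nat\<close>.\<close>

definition M1 :: "nat pmf set" where
  "M1 = {\<mu>. set_pmf \<mu> \<subseteq> {1..}}"

text \<open>The law of the process with initial distribution \<open>\<mu>\<close>, i.e. the mixture
  \<open>\<Sum>i. \<mu> i * P i\<close>.\<close>

definition law :: "(nat \<Rightarrow> 'w measure) \<Rightarrow> nat pmf \<Rightarrow> 'w measure" where
  "law P \<mu> = Giry_Monad.bind (measure_pmf \<mu>) P"

definition absorption_time :: "(real \<Rightarrow> 'w \<Rightarrow> nat) \<Rightarrow> 'w \<Rightarrow> ereal" where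
  "absorption_time X \<omega> = Inf {ereal t | t. 0 \<le> t \<and> X t \<omega> = 0}"

definition conditional_law ::
  "(nat \<Rightarrow> 'w measure) \<Rightarrow> (real \<Rightarrow> 'w \<Rightarrow> nat) \<Rightarrow> nat pmf \<Rightarrow> real \<Rightarrow> nat set \<Rightarrow> real" where
  "conditional_law P X \<mu> t A =
     \<P>(\<omega> in law P \<mu>. X t \<omega> \<in> A \<bar> ereal t < absorption_time X \<omega>)"

definition quasi_stationary ::
  "(nat \<Rightarrow> 'w measure) \<Rightarrow> (real \<Rightarrow> 'w \<Rightarrow> nat) \<Rightarrow> nat pmf \<Rightarrow> bool" where
  "quasi_stationary P X \<rho> \<longleftrightarrow>
     \<rho> \<in> M1 \<and> (\<forall>t\<ge>0. \<forall>A. conditional_law P X \<rho> t A = measure_pmf.prob \<rho> A)"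

definition domain_of_attraction ::
  "(nat \<Rightarrow> 'w measure) \<Rightarrow> (real \<Rightarrow> 'w \<Rightarrow> nat) \<Rightarrow> nat pmf \<Rightarrow> nat pmf set" where
  "domain_of_attraction P X \<rho> =
     {\<mu> \<in> M1. \<forall>j\<ge>1. ((\<lambda>t. conditional_law P X \<mu> t {j}) \<longlongrightarrow> pmf \<rho> j) at_top}"

definition is_minimal_qsd ::
  "(nat \<Rightarrow> 'w measure) \<Rightarrow> (real \<Rightarrow> 'w \<Rightarrow> nat) \<Rightarrow> nat pmf \<Rightarrow> bool" where
  "is_minimal_qsd P X \<rho> \<longleftrightarrow>
     quasi_stationary P X \<rho> \<and> (\<forall>x\<ge>1. return_pmf x \<in> domain_of_attraction P X \<rho>)"

definition minimal_qsd ::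
  "(nat \<Rightarrow> 'w measure) \<Rightarrow> (real \<Rightarrow> 'w \<Rightarrow> nat) \<Rightarrow> nat pmf" where
  "minimal_qsd P X = (THE \<rho>. is_minimal_qsd P X \<rho>)"

text \<open>The value at index \<open>0\<close> is a convention: with it the relation
  \<open>b 1 * Q 2 = b 1 + d 1 - x\<close> is the case \<open>n = 1\<close> of the general recurrence
  \<open>b n * Q (n + 1) = (b n + d n - x) * Q n - d n * Q (n - 1)\<close>.\<close>

fun Q :: "(nat \<Rightarrow> real) \<Rightarrow> (nat \<Rightarrow> real) \<Rightarrow> nat \<Rightarrow> real \<Rightarrow> real" where
  "Q b d 0 x = 0"
| "Q b d (Suc 0) x = 1"
| "Q b d (Suc (Suc n)) x =
     ((b (Suc n) + d (Suc n) - x) * Q b d (Suc n) x - d (Suc n) * Q b d n x) / b (Suc n)"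

declare Q.simps(3) [simp del]

definition xi1 :: "(nat \<Rightarrow> real) \<Rightarrow> (nat \<Rightarrow> real) \<Rightarrow> real" where
  "xi1 b d = (THE \<xi>. 0 \<le> \<xi> \<and> (\<forall>x. x \<le> \<xi> \<longleftrightarrow> (\<forall>n\<ge>1. 0 < Q b d n x)))"

definition xi1_positive_recurrent ::
  "(nat \<Rightarrow> real) \<Rightarrow> (nat \<Rightarrow> real) \<Rightarrow> (nat \<Rightarrow> 'w measure) \<Rightarrow> (real \<Rightarrow> 'w \<Rightarrow> nat) \<Rightarrow> bool" where
  "xi1_positive_recurrent b d P X \<longleftrightarrow>
     0 < xi1 b d \<and>
     (\<exists>i\<ge>1. \<exists>L>0. ((\<lambda>t. exp (xi1 b d * t) * \<P>(\<omega> in P i. X t \<omega> = i)) \<longlongrightarrow> L) at_top)"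

text \<open>The definite descriptions above are meaningful: \<open>\<xi>\<^sub>1\<close> exists and is unique for
  positive rates, and there is at most one minimal quasi-stationary distribution.\<close>

lemma Q_recurrence:
  assumes "b n > 0" "n \<ge> 1"
  shows "b n * Q b d (n + 1) x = (b n + d n - x) * Q b d n x - d n * Q b d (n - 1) x"
  using assms by (cases n) (auto simp: Q.simps(3))

lemma Q_downward:
  assumes pos: "\<And>i. i \<ge> 1 \<Longrightarrow> b i > 0 \<and> d i > 0"
    and x: "\<And>n. n \<ge> 1 \<Longrightarrow> 0 < Q b d n x" and "y \<le> x"
  shows "Q b d (Suc n) x * Q b d n y \<le> Q b d (Suc n) y * Q b d n x \<and> 0 < Q b d (Suc n) y"
proof (induction n)
  case 0
  show ?case by simp
next
  case (Suc n)
  let ?m = "Suc n"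
  have b: "b ?m > 0" "d ?m > 0" using pos[of ?m] by auto
  have r: "b ?m * Q b d (Suc ?m) z = (b ?m + d ?m - z) * Q b d ?m z - d ?m * Q b d n z" for z
    using b by (simp add: Q.simps(3))
  have xp: "0 < Q b d ?m x" "0 < Q b d (Suc ?m) x" using x by simp_all
  have yp: "0 < Q b d ?m y" using Suc by auto
  have "b ?m * (Q b d (Suc ?m) y * Q b d ?m x - Q b d (Suc ?m) x * Q b d ?m y)
      = (b ?m * Q b d (Suc ?m) y) * Q b d ?m x - (b ?m * Q b d (Suc ?m) x) * Q b d ?m y"
    by (simp only: algebra_simps)
  also have "\<dots> = (x - y) * (Q b d ?m y * Q b d ?m x)
        + d ?m * (Q b d ?m y * Q b d n x - Q b d ?m x * Q b d n y)"
    unfolding r by (simp only: algebra_simps)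
  also have "\<dots> \<ge> 0"
    using Suc xp yp b \<open>y \<le> x\<close> by (intro add_nonneg_nonneg mult_nonneg_nonneg) auto
  finally have "Q b d (Suc ?m) x * Q b d ?m y \<le> Q b d (Suc ?m) y * Q b d ?m x"
    using b by (simp only: zero_le_mult_iff) linarith
  moreover have "0 < Q b d (Suc ?m) x * Q b d ?m y" using xp yp by simp
  ultimately show ?case using xp
    by (metis less_le_trans zero_less_mult_pos2)
qed

lemma Q_zero_increasing:
  assumes pos: "\<And>i. i \<ge> 1 \<Longrightarrow> b i > 0 \<and> d i > 0"
  shows "Q b d n 0 \<le> Q b d (Suc n) 0 \<and> 0 < Q b d (Suc n) 0"
proof (induction n)
  case 0
  show ?case by simp
next
  case (Suc n)
  let ?m = "Suc n"
  have b: "b ?m > 0" "d ?m > 0" using pos[of ?m] by auto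
  have "b ?m * Q b d (Suc ?m) 0 = (b ?m + d ?m - 0) * Q b d ?m 0 - d ?m * Q b d n 0"
    using b by (simp add: Q.simps(3))
  also have "\<dots> = b ?m * Q b d ?m 0 + d ?m * (Q b d ?m 0 - Q b d n 0)"
    by (simp add: algebra_simps)
  also have "\<dots> \<ge> b ?m * Q b d ?m 0" using b Suc by auto
  finally have "Q b d ?m 0 \<le> Q b d (Suc ?m) 0" using b by (simp only: mult_le_cancel_left_pos)
  then show ?case using Suc by auto
qed

lemma continuous_Q: "continuous_on UNIV (Q b d n)"
proof (induction n rule: less_induct)
  case (less n)
  consider "n = 0" | "n = 1" | k where "n = Suc (Suc k)" by (metis One_nat_def not0_implies_Suc)
  then show ?case
  proof cases
    case 3
    have e: "Q b d n = (\<lambda>x. ((b (Suc k) + d (Suc k) - x) * Q b d (Suc k) x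
      - d (Suc k) * Q b d k x) * (1 / b (Suc k)))" by (auto simp: 3 Q.simps(3))
    show ?thesis unfolding e using less[of k] less[of "Suc k"] 3
      by (intro continuous_intros) auto
  qed auto
qed

lemma xi1_ex1:
  assumes pos: "\<And>i. i \<ge> 1 \<Longrightarrow> b i > 0 \<and> d i > 0"
  shows "\<exists>!\<xi>. 0 \<le> \<xi> \<and> (\<forall>x. x \<le> \<xi> \<longleftrightarrow> (\<forall>n\<ge>1. 0 < Q b d n x))"
proof (rule ex_ex1I)
  define S where "S = {x. \<forall>n\<ge>1. 0 < Q b d n x}"
  have S_iff: "x \<in> S \<longleftrightarrow> (\<forall>n. 0 < Q b d (Suc n) x)" for x
    unfolding S_def mem_Collect_eq
  proof (intro iffI allI impI)
    fix n :: nat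
    assume "\<forall>n. 0 < Q b d (Suc n) x" "1 \<le> n"
    then show "0 < Q b d n x" by (cases n) simp_all
  qed simp
  have zero: "0 \<in> S" unfolding S_iff
    using Q_zero_increasing[of b d, OF pos] by simp
  have down: "y \<in> S" if "x \<in> S" "y \<le> x" for x y
  proof -
    have "0 < Q b d n x" if "n \<ge> 1" for n using \<open>x \<in> S\<close> that by (simp add: S_def)
    then show ?thesis unfolding S_iff using Q_downward[of b d x y, OF pos _ \<open>y \<le> x\<close>] by simp
  qed
  have bd: "x \<le> b 1 + d 1" if "x \<in> S" for x
  proof -
    have "0 < Q b d (Suc (Suc 0)) x" using that unfolding S_iff by blast
    then show ?thesis using pos[of 1] by (simp add: Q.simps(3) field_simps)
  qed
  then have bdd: "bdd_above S" by (auto simp: bdd_above_def)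
  define \<xi> where "\<xi> = Sup S"
  have \<xi>0: "0 \<le> \<xi>" unfolding \<xi>_def by (rule cSup_upper[OF zero bdd])
  have ge: "0 \<le> Q b d n \<xi>" for n
  proof -
    have "S \<subseteq> {x. 0 \<le> Q b d n x}"
      by (cases n) (auto simp: S_iff intro: less_imp_le)
    moreover have "closed {x. 0 \<le> Q b d n x}"
      by (intro closed_Collect_le continuous_on_const continuous_Q)
    ultimately have "closure S \<subseteq> {x. 0 \<le> Q b d n x}" by (simp add: closure_minimal)
    moreover have "\<xi> \<in> closure S" unfolding \<xi>_def
      using zero bdd by (intro closure_contains_Sup) auto
    ultimately show ?thesis by auto
  qed
  have "0 < Q b d (Suc n) \<xi>" for n
  proof (induction n)
    case (Suc n)
    let ?m = "Suc n"
    let ?k = "Suc ?m"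
    have b: "b ?k > 0" "d ?k > 0" using pos[of ?k] by auto
    have "Q b d ?k \<xi> \<noteq> 0"
    proof
      assume "Q b d ?k \<xi> = 0"
      moreover have "b ?k * Q b d (Suc ?k) \<xi> = (b ?k + d ?k - \<xi>) * Q b d ?k \<xi> - d ?k * Q b d ?m \<xi>"
        using b by (simp add: Q.simps(3)[of b d ?m \<xi>])
      ultimately have "b ?k * Q b d (Suc ?k) \<xi> = - (d ?k * Q b d ?m \<xi>)"
        by simp
      moreover have "0 < d ?k * Q b d ?m \<xi>" "0 \<le> b ?k * Q b d (Suc ?k) \<xi>"
        using b Suc ge by simp_all
      ultimately show False by linarith
    qed
    then show ?case using ge[of ?k] by linarith
  qed simp
  then have "\<xi> \<in> S" unfolding S_iff by blast
  then have "x \<le> \<xi> \<longleftrightarrow> x \<in> S" for x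
    using down cSup_upper[OF _ bdd] unfolding \<xi>_def by blast
  then show "\<exists>\<xi>. 0 \<le> \<xi> \<and> (\<forall>x. x \<le> \<xi> \<longleftrightarrow> (\<forall>n\<ge>1. 0 < Q b d n x))"
    using \<xi>0 unfolding S_def by auto
next
  fix \<xi> \<xi>'
  assume "0 \<le> \<xi> \<and> (\<forall>x. x \<le> \<xi> \<longleftrightarrow> (\<forall>n\<ge>1. 0 < Q b d n x))"
    and "0 \<le> \<xi>' \<and> (\<forall>x. x \<le> \<xi>' \<longleftrightarrow> (\<forall>n\<ge>1. 0 < Q b d n x))"
  then have "\<forall>x. x \<le> \<xi> \<longleftrightarrow> x \<le> \<xi>'" by simp
  then show "\<xi> = \<xi>'" by (meson order_antisym order_refl)
qed

lemma minimal_qsd_unique: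
  assumes "is_minimal_qsd P X \<rho>" "is_minimal_qsd P X \<rho>'"
  shows "\<rho> = \<rho>'"
proof (rule pmf_eqI)
  fix j
  show "pmf \<rho> j = pmf \<rho>' j"
  proof (cases "j = 0")
    case True
    have "\<rho> \<in> M1" "\<rho>' \<in> M1" using assms by (auto simp: is_minimal_qsd_def quasi_stationary_def)
    then have "j \<notin> set_pmf \<rho>" "j \<notin> set_pmf \<rho>'" using True by (auto simp: M1_def)
    then show ?thesis by (simp add: set_pmf_iff)
  next
    case False
    have "((\<lambda>t. conditional_law P X (return_pmf 1) t {j}) \<longlongrightarrow> pmf r j) at_top"
      if "is_minimal_qsd P X r" for r
      using that False by (auto simp: is_minimal_qsd_def domain_of_attraction_def)
    with assms show ?thesis using tendsto_unique[OF trivial_limit_at_top_linorder] by blast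
  qed
qed

lemma (in birth_death_process) emeasure_law:
  assumes "A \<in> sets (P 0)"
  shows "emeasure (law P \<mu>) A = (\<integral>\<^sup>+i. emeasure (P i) A \<partial>measure_pmf \<mu>)"
proof -
  have "P i \<in> space (subprob_algebra (P 0))" for i
    using prob_space_P[of i] sets_P[of i 0]
    by (simp add: space_subprob_algebra prob_space_imp_subprob_space)
  then show ?thesis unfolding law_def
    using assms by (intro emeasure_bind[where N = "P 0"]) auto
qed

end

(*
  Write p i j t for the transition probabilities, a = xi1, q = Q(a), and w for the reversible
  measure. Divergence of the scale function V gives a maximum principle for the backward equation
  and the symmetry w i * p i j t = w j * p j i t. By comparison with q, the functions
  S i j t = exp (a t) * p i j t are bounded by q i / q j. The identity

    S i i (2 t) - 2 * S i i (s + t) + S i i (2 s) = (SUM k. w k / w i * (S k i t - S k i s)^2)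

  shows first that S i i is midpoint convex, hence (being bounded) nonincreasing and convergent,
  and then that every S k i converges. The limit in k is an eigenvector, so S i j tends to
  c * q i * w j * q j by symmetry, and c > 0 is positive recurrence. Absorption happens at rate
  d 1 * p i 1, which yields the asymptotics exp (a t) * (1 - p i 0 t) --> d 1 / a * c * q i with
  the bound d 1 / a * q i. Dominated convergence then attracts every mu with finite integral of q
  to the law a / d 1 * w j * q j. A Lyapunov function phi dominates a multiple of q near infinity.
*)
theory Submission
  imports Defs "HOL-Real_Asymp.Real_Asymp"
begin

section \<open>Functions of a real variable\<close>

text \<open>No spectral representation is used: \<open>S i i (2 * t)\<close> is the squared norm of
  \<open>k \<mapsto> S k i t\<close> with weights \<open>w k / w i\<close>, and convexity takes the
  place of spectral calculus. The obstacle is infinity. The rates may be unbounded, so summation by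
  parts leaves a boundary term far out, and the forward equation is not immediate. Everything is
  therefore drawn from the backward equation, with \<open>V\<close> as a barrier: it is harmonic and
  unbounded, so subtracting \<open>e * V\<close> confines the positive part of a bounded subsolution
  to a finite set. The boundary terms in the proof of symmetry are tamed by the bounded variation of
  \<open>n \<mapsto> p n i t\<close>, a consequence of monotonicity in the starting state. The
  constant \<open>a / d 1\<close> is a mass balance: a quasi-stationary law decaying at rate
  \<open>a\<close> can only leak from state 1, at rate \<open>d 1\<close>, so it gives state 1 the
  mass \<open>a / d 1\<close>, while \<open>w 1 = q 1 = 1\<close>. Passing to the limit in partial
  sums only shows total mass at most 1; equality comes from making this balance rigorous at time 0.
  The strict inequality between \<lambda>_1 and \<xi>_1 pays for the constant
  \<open>C\<close>.\<close>

lemma tannery_eventually: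
  fixes a :: "nat \<Rightarrow> 'b \<Rightarrow> real"
  assumes "\<And>k. (a k \<longlongrightarrow> g k) F" "eventually (\<lambda>t. \<forall>k. \<bar>a k t\<bar> \<le> M k) F" "summable M" "F \<noteq> bot"
  shows "((\<lambda>t. \<Sum>k. a k t) \<longlongrightarrow> (\<Sum>k. g k)) F"
proof -
  have "eventually (\<lambda>(k, t). norm (a k t) \<le> M k) (at_top \<times>\<^sub>F F)"
    unfolding eventually_prod_filter
    using assms(2) by (intro exI[of _ "\<lambda>_. True"] exI[of _ "\<lambda>t. \<forall>k. \<bar>a k t\<bar> \<le> M k"]) auto
  from tannerys_theorem[OF assms(1) this assms(3,4)] show ?thesis by simp
qed

text \<open>By the mean value theorem the increments of \<open>f\<close> over unit intervals are
  values of \<open>f'\<close> at points tending to infinity, and they tend to 0. The intervals start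
  at \<open>n + 1\<close> to avoid the one-sided derivative at 0. This turns the backward equation
  into an eigenvalue equation for limits in time.\<close>

lemma derivative_limit_zero:
  fixes f :: "real \<Rightarrow> real"
  assumes der: "\<And>t. 0 \<le> t \<Longrightarrow> (f has_real_derivative f' t) (at t within {0..})"
    and f: "(f \<longlongrightarrow> l) at_top" and f': "(f' \<longlongrightarrow> m) at_top"
  shows "m = 0"
proof -
  have D: "DERIV f x :> f' x" if "0 < x" for x
    using der[of x] that by (simp add: at_within_interior[of x "{0..}"])
  have "\<exists>z. real n + 1 < z \<and> z < real n + 2 \<and> f (real n + 2) - f (real n + 1) = f' z" for n
    using MVT2[of "real n + 1" "real n + 2" f f'] D by auto
  then obtain z where z: "\<And>n. real n + 1 < z n" "\<And>n. f (real n + 2) - f (real n + 1) = f' (z n)"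
    by metis
  have up: "filterlim (\<lambda>n. real n + c) at_top sequentially" for c
    using filterlim_tendsto_add_at_top[OF tendsto_const[of c] filterlim_real_sequentially]
    by (simp add: add.commute)
  have "filterlim z at_top sequentially"
    by (rule filterlim_at_top_mono[OF up[of 1]]) (simp add: less_imp_le z)
  then have "(\<lambda>n. f' (z n)) \<longlonglongrightarrow> m" by (rule filterlim_compose[OF f'])
  moreover have "(\<lambda>n. f (real n + 2) - f (real n + 1)) \<longlonglongrightarrow> l - l"
    by (intro tendsto_diff filterlim_compose[OF f] up)
  ultimately show ?thesis using z(2) LIMSEQ_unique by fastforce
qed

lemma nondecreasing_tendsto_zero_nonpos:
  fixes F :: "real \<Rightarrow> real"
  assumes der: "\<And>s. t \<le> s \<Longrightarrow> (F has_real_derivative F' s) (at s within {t..})"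
    and nn: "\<And>s. t \<le> s \<Longrightarrow> 0 \<le> F' s" and lim: "(F \<longlongrightarrow> 0) at_top"
  shows "F t \<le> 0"
proof -
  have mono: "F t \<le> F s" if "t \<le> s" for s
  proof (rule DERIV_nonneg_imp_increasing_open[OF that])
    show "\<exists>y. DERIV F x :> y \<and> 0 \<le> y" if "t < x" for x
      using der[of x] nn[of x] that by (auto simp: at_within_interior[of x "{t..}"])
    show "continuous_on {t..s} F"
      using der by (intro continuous_on_subset[OF DERIV_continuous_on[of "{t..}" F F']]) auto
  qed
  have "eventually (\<lambda>s. F t \<le> F s) at_top"
    using mono by (auto simp: eventually_at_top_linorder)
  then show ?thesis by (intro tendsto_lowerbound[OF lim]) auto
qed

lemma exp_tail_upper:
  fixes h g :: "real \<Rightarrow> real"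
  assumes "0 < a"
    and der: "\<And>s. t \<le> s \<Longrightarrow> (h has_real_derivative - g s) (at s within {t..})"
    and lim: "(h \<longlongrightarrow> 0) at_top"
    and bound: "\<And>s. t \<le> s \<Longrightarrow> exp (a * s) * g s \<le> M"
  shows "exp (a * t) * h t \<le> M / a"
proof -
  have "h t - M / a * exp (- (a * t)) \<le> 0"
  proof (rule nondecreasing_tendsto_zero_nonpos[where F = "\<lambda>t. h t - M / a * exp (- (a * t))" and F' = "\<lambda>s. - g s + M * exp (- (a * s))"])
    fix s assume s: "t \<le> s"
    show "((\<lambda>t. h t - M / a * exp (- (a * t))) has_real_derivative - g s + M * exp (- (a * s)))
        (at s within {t..})"
      using \<open>0 < a\<close> by (auto intro!: derivative_eq_intros der[OF s])
    have "g s = exp (- (a * s)) * (exp (a * s) * g s)"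
      by (simp add: exp_minus)
    also have "\<dots> \<le> exp (- (a * s)) * M" by (intro mult_left_mono bound s) simp
    finally show "0 \<le> - g s + M * exp (- (a * s))" by (simp add: mult.commute)
  next
    have "((\<lambda>t. exp (- (a * t))) \<longlongrightarrow> 0) at_top"
      using \<open>0 < a\<close> by real_asymp
    from tendsto_diff[OF lim tendsto_mult_right_zero[OF this, of "M / a"]]
    show "((\<lambda>t. h t - M / a * exp (- (a * t))) \<longlongrightarrow> 0) at_top" by simp
  qed
  then have "exp (a * t) * h t \<le> exp (a * t) * (M / a * exp (- (a * t)))"
    by (intro mult_left_mono) auto
  then show ?thesis by (simp add: exp_minus field_simps)
qed

text \<open>Past the time where \<open>exp (a * s) * g s\<close> is within \<open>a * e / 2\<close>
  of its limit, \<open>exp_tail_upper\<close> applies to \<open>h\<close> and to \<open>- h\<close>;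
  division by \<open>a\<close> leaves an error of \<open>e / 2\<close>.\<close>

lemma exp_tail_tendsto:
  fixes h g :: "real \<Rightarrow> real"
  assumes a: "0 < a"
    and der: "\<And>s. 0 \<le> s \<Longrightarrow> (h has_real_derivative - g s) (at s within {0..})"
    and lim: "(h \<longlongrightarrow> 0) at_top"
    and g: "((\<lambda>s. exp (a * s) * g s) \<longlongrightarrow> l) at_top"
  shows "((\<lambda>s. exp (a * s) * h s) \<longlongrightarrow> l / a) at_top"
proof (rule tendstoI)
  fix e :: real assume e: "0 < e"
  then have "0 < a * e / 2" using a by simp
  from tendstoD[OF g this] obtain T where T: "\<And>s. T \<le> s \<Longrightarrow> \<bar>exp (a * s) * g s - l\<bar> < a * e / 2"
    by (auto simp: eventually_at_top_linorder dist_real_def)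
  have "\<bar>exp (a * t) * h t - l / a\<bar> < e" if t: "max 0 T \<le> t" for t
  proof -
    have d: "(h has_real_derivative - g s) (at s within {t..})" if "t \<le> s" for s
      using der[of s] \<open>max 0 T \<le> t\<close> that by (auto intro: DERIV_subset)
    have d': "((\<lambda>s. - h s) has_real_derivative - (- g s)) (at s within {t..})" if "t \<le> s" for s
      using d[OF that] by (rule DERIV_minus)
    have b: "exp (a * s) * g s \<le> l + a * e / 2" "exp (a * s) * (- g s) \<le> - l + a * e / 2" if "t \<le> s" for s
      using T[of s] t that by (simp_all, linarith+)
    have "exp (a * t) * h t \<le> (l + a * e / 2) / a"
      using b by (intro exp_tail_upper[OF a d lim])
    moreover have "exp (a * t) * (- h t) \<le> (- l + a * e / 2) / a"
      using b tendsto_minus[OF lim] by (intro exp_tail_upper[OF a d']) auto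
    ultimately have "\<bar>exp (a * t) * h t - l / a\<bar> \<le> e / 2"
      unfolding abs_le_iff using a by (simp add: field_simps)
    with e show ?thesis by simp
  qed
  then show "eventually (\<lambda>t. dist (exp (a * t) * h t) (l / a) < e) at_top"
    unfolding eventually_at_top_linorder dist_real_def by blast
qed

text \<open>If \<open>f\<close> increased from \<open>x\<close> to \<open>y\<close>, midpoint
  convexity would keep the increments along \<open>x + n * (y - x)\<close> at least as large as the
  first one, and \<open>f\<close> would grow linearly. Convexity is stated at the points
  \<open>2 * s\<close> and \<open>2 * t\<close> because Chapman-Kolmogorov delivers it in that
  shape.\<close>

lemma midpoint_convex_bounded_antimono:
  fixes f :: "real \<Rightarrow> real"
  assumes bdd: "\<And>t. 0 \<le> t \<Longrightarrow> f t \<le> B"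
    and conv: "\<And>s t. 0 \<le> s \<Longrightarrow> 0 \<le> t \<Longrightarrow> 2 * f (s + t) \<le> f (2 * s) + f (2 * t)"
    and "0 \<le> x" "x \<le> y"
  shows "f y \<le> f x"
proof (rule ccontr)
  assume "\<not> f y \<le> f x"
  define h where "h = y - x"
  define e where "e = f y - f x"
  have h: "0 \<le> h" and e: "0 < e" using assms \<open>\<not> f y \<le> f x\<close> by (auto simp: h_def e_def)
  define z where "z n = x + real n * h" for n
  have step: "e \<le> f (z (Suc n)) - f (z n)" for n
  proof (induction n)
    case 0
    show ?case by (simp add: z_def h_def e_def)
  next
    case (Suc n)
    have "2 * f (z n / 2 + z (Suc (Suc n)) / 2) \<le> f (2 * (z n / 2)) + f (2 * (z (Suc (Suc n)) / 2))"
      using h \<open>0 \<le> x\<close> by (intro conv) (auto simp: z_def)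
    moreover have "z n / 2 + z (Suc (Suc n)) / 2 = z (Suc n)" by (simp add: z_def field_simps)
    ultimately show ?case using Suc by simp
  qed
  have grow: "f x + real n * e \<le> f (z n)" for n
  proof (induction n)
    case (Suc n)
    then show ?case using step[of n] by (simp add: algebra_simps)
  qed (simp add: z_def)
  obtain n where "B - f x < real n * e" using reals_Archimedean3[OF e] by blast
  moreover have "f (z n) \<le> B" using h \<open>0 \<le> x\<close> by (intro bdd) (auto simp: z_def)
  ultimately show False using grow[of n] by simp
qed

lemma antimono_bounded_below_convergent:
  fixes f :: "real \<Rightarrow> real"
  assumes mono: "\<And>s t. 0 \<le> s \<Longrightarrow> s \<le> t \<Longrightarrow> f t \<le> f s" and bdd: "\<And>t. 0 \<le> t \<Longrightarrow> c \<le> f t"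
  obtains l where "(f \<longlongrightarrow> l) at_top" "c \<le> l"
proof
  have b: "bdd_below (f ` {0..})" using bdd by (intro bdd_belowI2[of _ c]) auto
  show "c \<le> Inf (f ` {0..})" using bdd by (intro cINF_greatest) auto
  show "(f \<longlongrightarrow> Inf (f ` {0..})) at_top"
  proof (rule decreasing_tendsto)
    show "eventually (\<lambda>t. Inf (f ` {0..}) \<le> f t) at_top"
      using b by (auto intro!: eventually_at_top_linorderI[of 0] cINF_lower)
    fix x assume "Inf (f ` {0..}) < x"
    then obtain s where "0 \<le> s" "f s < x" using b by (auto simp: cINF_less_iff)
    then show "eventually (\<lambda>t. f t < x) at_top"
      using mono by (intro eventually_at_top_linorderI[of s]) (meson order.trans le_less_trans)
  qed
qed

lemma cauchy_at_top_convergent: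
  fixes f :: "real \<Rightarrow> real"
  assumes "\<And>e. 0 < e \<Longrightarrow> \<exists>T. \<forall>s\<ge>T. \<forall>t\<ge>T. \<bar>f s - f t\<bar> < e"
  obtains l where "(f \<longlongrightarrow> l) at_top"
proof -
  have "Cauchy (\<lambda>n. f (real n))"
  proof (rule metric_CauchyI)
    fix e :: real assume "0 < e"
    then obtain T where T: "\<forall>s\<ge>T. \<forall>t\<ge>T. \<bar>f s - f t\<bar> < e" using assms by blast
    obtain N where "T \<le> real N" using real_arch_simple by blast
    then have "T \<le> real n" if "N \<le> n" for n using that by linarith
    then show "\<exists>M. \<forall>m\<ge>M. \<forall>n\<ge>M. dist (f (real m)) (f (real n)) < e"
      using T unfolding dist_real_def by blast
  qed
  then obtain l where l: "(\<lambda>n. f (real n)) \<longlonglongrightarrow> l"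
    using Cauchy_convergent_iff convergent_def by blast
  have "(f \<longlongrightarrow> l) at_top"
  proof (rule tendstoI)
    fix e :: real assume e: "0 < e"
    then obtain T where T: "\<forall>s\<ge>T. \<forall>t\<ge>T. \<bar>f s - f t\<bar> < e / 2" using assms[of "e / 2"] by auto
    have "eventually (\<lambda>n. T \<le> real n \<and> dist (f (real n)) l < e / 2) sequentially"
      using e by (intro eventually_conj tendstoD[OF l] filterlim_real_sequentially[unfolded filterlim_at_top, rule_format]) auto
    then obtain n where "T \<le> real n" "\<bar>f (real n) - l\<bar> < e / 2"
      by (auto simp: eventually_sequentially dist_real_def)
    then have "\<bar>f t - l\<bar> < e" if "T \<le> t" for t
    proof -
      have "\<bar>f t - f (real n)\<bar> < e / 2" using T that \<open>T \<le> real n\<close> by blast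
      with \<open>\<bar>f (real n) - l\<bar> < e / 2\<close> show ?thesis by linarith
    qed
    then show "eventually (\<lambda>t. dist (f t) l < e) at_top"
      by (auto simp: eventually_at_top_linorder dist_real_def)
  qed
  then show ?thesis by (rule that)
qed

text \<open>A positive maximum over \<open>K\<close> and \<open>{0..T}\<close> is attained at a
  positive time by \<open>init\<close>. It is maximal over all indices by \<open>outside\<close>, so
  \<open>decr\<close> makes the time derivative negative, and a slightly earlier time would give a
  larger value. The index type is left open because the principle is used both for states and for
  pairs of states.\<close>

lemma parabolic_maximum_principle:
  fixes w w' :: "'a \<Rightarrow> real \<Rightarrow> real"
  assumes K: "finite K"
    and outside: "\<And>a t. a \<notin> K \<Longrightarrow> 0 \<le> t \<Longrightarrow> t \<le> T \<Longrightarrow> w a t \<le> 0"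
    and der: "\<And>a t. a \<in> K \<Longrightarrow> 0 \<le> t \<Longrightarrow> t \<le> T \<Longrightarrow> (w a has_real_derivative w' a t) (at t within {0..T})"
    and init: "\<And>a. a \<in> K \<Longrightarrow> w a 0 \<le> 0"
    and decr: "\<And>a t. a \<in> K \<Longrightarrow> 0 < t \<Longrightarrow> t \<le> T \<Longrightarrow> 0 < w a t \<Longrightarrow> (\<And>c. w c t \<le> w a t) \<Longrightarrow> w' a t < 0"
    and t: "0 \<le> t" "t \<le> T"
  shows "w a t \<le> 0"
proof (rule ccontr)
  assume "\<not> w a t \<le> 0"
  then have pos: "0 < w a t" by simp
  with outside t have a: "a \<in> K" by force
  have "\<exists>s\<in>{0..T}. \<forall>r\<in>{0..T}. w c r \<le> w c s" if "c \<in> K" for c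
    using t that der by (intro continuous_attains_sup) (auto intro!: DERIV_continuous_on)
  then obtain s where s: "\<And>c. c \<in> K \<Longrightarrow> s c \<in> {0..T}"
    "\<And>c r. c \<in> K \<Longrightarrow> r \<in> {0..T} \<Longrightarrow> w c r \<le> w c (s c)" by metis
  define M where "M = Max ((\<lambda>c. w c (s c)) ` K)"
  have "M \<in> (\<lambda>c. w c (s c)) ` K" unfolding M_def using K a by (intro Max_in) auto
  then obtain m where m: "m \<in> K" "M = w m (s m)" by auto
  have le: "w c r \<le> w m (s m)" if "c \<in> K" "r \<in> {0..T}" for c r
    using s(2)[OF that] K that unfolding m(2)[symmetric] M_def by (auto intro: order.trans Max_ge)
  have mpos: "0 < w m (s m)" using le[OF a, of t] t pos by auto
  have sm: "0 < s m" "s m \<le> T" using s(1)[OF m(1)] init[OF m(1)] mpos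
    by (auto simp: less_le intro: ccontr)
  have "w' m (s m) < 0"
  proof (rule decr[OF m(1) sm mpos])
    fix c show "w c (s m) \<le> w m (s m)"
      using le[of c "s m"] outside[of c "s m"] sm mpos by (cases "c \<in> K") auto
  qed
  from has_real_derivative_neg_dec_left[OF der[OF m(1), of "s m"] this] sm
  obtain e where e: "0 < e" "\<And>h. 0 < h \<Longrightarrow> s m - h \<in> {0..T} \<Longrightarrow> h < e \<Longrightarrow> w m (s m) < w m (s m - h)"
    by auto
  have "w m (s m) < w m (s m - min (e / 2) (s m))" using e(1) sm by (intro e(2)) auto
  moreover have "w m (s m - min (e / 2) (s m)) \<le> w m (s m)" using sm e(1) by (intro le m(1)) auto
  ultimately show False by simp
qed

section \<open>The backward equation\<close>

lemma bd_generator_diff: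
  "bd_generator b d (\<lambda>k. f k - g k) i = bd_generator b d f i - bd_generator b d g i"
  by (simp add: bd_generator_def algebra_simps)

lemma bd_generator_cmult:
  "bd_generator b d (\<lambda>k. c * f k) i = c * bd_generator b d f i"
  by (simp add: bd_generator_def algebra_simps)

lemma bd_generator_sum:
  "bd_generator b d (\<lambda>k. \<Sum>j\<in>A. f j k) i = (\<Sum>j\<in>A. bd_generator b d (f j) i)"
  by (simp add: bd_generator_def sum_distrib_left sum.distrib sum_subtractf algebra_simps)

lemma bd_generator_Q:
  assumes "\<And>i. 1 \<le> i \<Longrightarrow> b i > 0" "1 \<le> i"
  shows "bd_generator b d (\<lambda>k. Q b d k x) i = - x * Q b d i x"
  using Q_recurrence[of b i d x] assms by (simp add: bd_generator_def algebra_simps)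

text \<open>The analytic content of the process, detached from the probability space.
  Differentiability is given at time 0 only; the backward equation at later times is derived from
  it.\<close>

locale birth_death_semigroup =
  fixes b d :: "nat \<Rightarrow> real" and p :: "nat \<Rightarrow> nat \<Rightarrow> real \<Rightarrow> real"
  assumes b0: "b 0 = 0" and d0: "d 0 = 0"
    and b_pos: "1 \<le> i \<Longrightarrow> 0 < b i" and d_pos: "1 \<le> i \<Longrightarrow> 0 < d i"
    and recurrent: "filterlim (\<lambda>N. \<Sum>n=1..N. (\<Prod>k=1..n. d k) / (\<Prod>k=1..n. b k)) at_top sequentially"
    and p_nonneg: "0 \<le> t \<Longrightarrow> 0 \<le> p i j t"
    and p_sums_1: "0 \<le> t \<Longrightarrow> (\<lambda>j. p i j t) sums 1"
    and chapman_kolmogorov: "0 \<le> s \<Longrightarrow> 0 \<le> t \<Longrightarrow> (\<lambda>k. p i k s * p k j t) sums p i j (s + t)"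
    and p_zero: "p i j 0 = (if i = j then 1 else 0)"
    and p_rates: "((\<lambda>h. p i j h) has_real_derivative bd_rate b d i j) (at 0 within {0..})"
begin

lemma p_le_1: "0 \<le> t \<Longrightarrow> p i j t \<le> 1"
  using sum_le_suminf[OF sums_summable[OF p_sums_1], of t "{j}" i] p_sums_1[of t i] p_nonneg
  by (auto simp: sums_iff)

lemma sum_p_le_1: "0 \<le> t \<Longrightarrow> finite A \<Longrightarrow> (\<Sum>j\<in>A. p i j t) \<le> 1"
  using sum_le_suminf[OF sums_summable[OF p_sums_1], of t A i] p_sums_1[of t i] p_nonneg
  by (auto simp: sums_iff)

definition nbhd :: "nat \<Rightarrow> nat set" where "nbhd i = {i - 1, i, i + 1}"

text \<open>The probability of having moved by at least two states. Since the rates over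
  \<open>nbhd i\<close> add up to 0, it is of smaller order than \<open>t\<close> at 0, and it
  bounds the error of every one-step analysis.\<close>

definition escape :: "nat \<Rightarrow> real \<Rightarrow> real" where "escape i t = 1 - (\<Sum>k\<in>nbhd i. p i k t)"

lemma finite_nbhd [simp]: "finite (nbhd i)" and self_in_nbhd [simp]: "i \<in> nbhd i"
  by (auto simp: nbhd_def)

lemma sum_nbhd_rate: "(\<Sum>k\<in>nbhd i. bd_rate b d i k * f k) = bd_generator b d f i"
proof (cases i)
  case 0
  then show ?thesis by (simp add: nbhd_def bd_rate_def bd_generator_def b0 d0)
next
  case (Suc n)
  have "Suc n \<noteq> n" "Suc (Suc n) \<noteq> n" "Suc (Suc n) \<noteq> Suc n" by auto
  then show ?thesis by (simp add: Suc nbhd_def bd_rate_def bd_generator_def algebra_simps)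
qed

lemma escape_rate: "(escape i has_real_derivative 0) (at 0 within {0..})"
proof -
  have "(\<Sum>k\<in>nbhd i. bd_rate b d i k) = 0"
    using sum_nbhd_rate[of i "\<lambda>_. 1"] by (simp add: bd_generator_def)
  then show ?thesis unfolding escape_def[abs_def]
    by (auto intro!: derivative_eq_intros p_rates)
qed

lemma escape_zero: "escape i 0 = 0"
  by (simp add: escape_def p_zero)

text \<open>Chapman-Kolmogorov over the first time span \<open>h\<close>: targets outside
  \<open>nbhd i\<close> contribute at most \<open>escape i h\<close> because \<open>p k j t\<close>
  is at most 1, and the terms with \<open>p i k 0\<close> reproduce \<open>p i j t\<close>.\<close>

lemma first_step:
  assumes "0 \<le> h" "0 \<le> t"
  shows "\<bar>p i j (h + t) - p i j t - (\<Sum>k\<in>nbhd i. (p i k h - p i k 0) * p k j t)\<bar> \<le> escape i h"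
proof -
  define g where "g k = (if k \<in> nbhd i then p i k h * p k j t else 0)" for k
  define g1 where "g1 k = (if k \<in> nbhd i then p i k h else 0)" for k
  have "(\<Sum>k\<in>nbhd i. p i k 0 * p k j t) = (\<Sum>k\<in>nbhd i. if k = i then p i j t else 0)"
    by (intro sum.cong) (auto simp: p_zero)
  then have base: "(\<Sum>k\<in>nbhd i. p i k 0 * p k j t) = p i j t"
    by simp
  have s: "(\<lambda>k. p i k h * p k j t - g k) sums (p i j (h + t) - (\<Sum>k\<in>nbhd i. p i k h * p k j t))"
    unfolding g_def using assms by (intro sums_diff chapman_kolmogorov sums_If_finite_set) auto
  have s1: "(\<lambda>k. p i k h - g1 k) sums escape i h"
    unfolding g1_def escape_def using assms by (intro sums_diff p_sums_1 sums_If_finite_set) auto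
  have "p i j (h + t) - (\<Sum>k\<in>nbhd i. p i k h * p k j t) \<le> escape i h"
    by (rule sums_le[OF _ s s1]) (use assms in \<open>auto simp: g_def g1_def p_nonneg p_le_1 mult_left_le\<close>)
  moreover have "0 \<le> p i j (h + t) - (\<Sum>k\<in>nbhd i. p i k h * p k j t)"
    by (rule sums_le[OF _ sums_zero s]) (use assms in \<open>auto simp: g_def p_nonneg\<close>)
  moreover have "(\<Sum>k\<in>nbhd i. (p i k h - p i k 0) * p k j t)
      = (\<Sum>k\<in>nbhd i. p i k h * p k j t) - p i j t"
    by (simp add: left_diff_distrib sum_subtractf base)
  ultimately show ?thesis by simp
qed

text \<open>Applying \<open>first_step\<close> from the earlier of the two times, over a span
  \<open>\<bar>s - t\<bar>\<close>, gives a modulus of continuity \<open>u\<close> that does not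
  depend on \<open>t\<close>. Continuity from the left is thus obtained together with continuity
  from the right.\<close>

lemma p_continuous: "continuous_on {0..} (p i j)"
  unfolding continuous_on
proof
  fix t :: real assume t: "t \<in> {0..}"
  define u where "u h = (\<Sum>k\<in>nbhd i. \<bar>p i k h - p i k 0\<bar>) + escape i h" for h
  have bnd: "\<bar>p i j s - p i j t\<bar> \<le> u \<bar>s - t\<bar>" if s: "0 \<le> s" for s
  proof -
    define h where "h = \<bar>s - t\<bar>"
    define m where "m = min s t"
    have hm: "0 \<le> h" "0 \<le> m" using s t by (auto simp: h_def m_def)
    have "\<bar>p i j s - p i j t\<bar> = \<bar>p i j (h + m) - p i j m\<bar>"
      by (cases "s \<le> t") (auto simp: h_def m_def min_def)
    also have "\<dots> \<le> \<bar>\<Sum>k\<in>nbhd i. (p i k h - p i k 0) * p k j m\<bar> + escape i h"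
      using first_step[OF hm, of i j] by linarith
    also have "\<bar>\<Sum>k\<in>nbhd i. (p i k h - p i k 0) * p k j m\<bar> \<le> (\<Sum>k\<in>nbhd i. \<bar>p i k h - p i k 0\<bar>)"
      using hm by (intro order.trans[OF sum_abs] sum_mono) (auto simp: abs_mult p_nonneg p_le_1 mult_left_le)
    finally show ?thesis by (simp add: u_def h_def)
  qed
  have c: "(f \<longlongrightarrow> f 0) (at 0 within {0..})" if "(f has_real_derivative D) (at 0 within {0..})"
    for f :: "real \<Rightarrow> real" and D
    using DERIV_continuous[OF that] by (simp add: continuous_within)
  have abs_lim: "((\<lambda>s. \<bar>s - t\<bar>) \<longlongrightarrow> 0) (at t within {0..})"
    by (auto intro!: tendsto_eq_intros)
  have h: "filterlim (\<lambda>s. \<bar>s - t\<bar>) (at 0 within {0..}) (at t within {0..})"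
    unfolding filterlim_at using abs_lim by (auto simp: eventually_at_filter)
  have "((\<lambda>s. u \<bar>s - t\<bar>) \<longlongrightarrow> (\<Sum>k\<in>nbhd i. \<bar>p i k 0 - p i k 0\<bar>) + escape i 0) (at t within {0..})"
    unfolding u_def
    by (intro tendsto_intros filterlim_compose[OF c[OF p_rates] h] filterlim_compose[OF c[OF escape_rate] h])
  then have "((\<lambda>s. u \<bar>s - t\<bar>) \<longlongrightarrow> 0) (at t within {0..})" by (simp add: escape_zero)
  then have "((\<lambda>s. p i j s - p i j t) \<longlongrightarrow> 0) (at t within {0..})"
    by (rule Lim_null_comparison[rotated]) (auto simp: eventually_at_filter bnd intro!: always_eventually)
  then show "(p i j \<longlongrightarrow> p i j t) (at t within {0..})"
    using LIM_zero_cancel by blast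
qed

text \<open>Left and right difference quotients are treated at once by starting at
  \<open>min s t\<close> and moving by \<open>\<bar>s - t\<bar>\<close>. Continuity replaces
  \<open>p k j (min s t)\<close> by \<open>p k j t\<close> in the limit, and the error divided by
  the span vanishes by \<open>escape_rate\<close>.\<close>

lemma backward:
  assumes t: "0 \<le> t"
  shows "(p i j has_real_derivative bd_generator b d (\<lambda>k. p k j t) i) (at t within {0..})"
proof -
  define h where "h s = \<bar>s - t\<bar>" for s
  define m where "m s = min s t" for s
  define q where "q s = (\<Sum>k\<in>nbhd i. (p i k (h s) - p i k 0) / (h s - 0) * p k j (m s))" for s
  have c: "((\<lambda>h. (f h - f 0) / (h - 0)) \<longlongrightarrow> D) (at 0 within {0..})"
    if "(f has_real_derivative D) (at 0 within {0..})" for f :: "real \<Rightarrow> real" and D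
    using that by (simp add: has_field_derivative_iff)
  have h: "filterlim h (at 0 within {0..}) (at t within {0..})"
    unfolding filterlim_at h_def
    by (auto simp: eventually_at_filter intro!: tendsto_eq_intros)
  have m_lim: "(m \<longlongrightarrow> t) (at t within {0..})"
    unfolding m_def using tendsto_min[OF tendsto_ident_at[of t "{0..}"] tendsto_const[of t]] by simp
  have m: "((\<lambda>s. p k j (m s)) \<longlongrightarrow> p k j t) (at t within {0..})" for k
    using t by (intro continuous_on_tendsto_compose[OF p_continuous m_lim])
      (auto simp: eventually_at_filter m_def intro!: always_eventually)
  have "(q \<longlongrightarrow> (\<Sum>k\<in>nbhd i. bd_rate b d i k * p k j t)) (at t within {0..})"
    unfolding q_def by (intro tendsto_intros m filterlim_compose[OF c[OF p_rates] h])
  then have q: "(q \<longlongrightarrow> bd_generator b d (\<lambda>k. p k j t) i) (at t within {0..})"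
    by (simp add: sum_nbhd_rate)
  have e: "((\<lambda>s. (escape i (h s) - escape i 0) / (h s - 0)) \<longlongrightarrow> 0) (at t within {0..})"
    by (rule filterlim_compose[OF c[OF escape_rate] h])
  have bnd: "\<bar>(p i j s - p i j t) / (s - t) - q s\<bar> \<le> (escape i (h s) - escape i 0) / (h s - 0)"
    if s: "0 \<le> s" "s \<noteq> t" for s
  proof -
    have hm: "0 < h s" "0 \<le> m s" using s t by (auto simp: h_def m_def)
    have "(p i j s - p i j t) / (s - t) = (p i j (h s + m s) - p i j (m s)) / h s"
      using s by (cases "s \<le> t") (auto simp: h_def m_def min_def field_simps)
    moreover have "q s = (\<Sum>k\<in>nbhd i. (p i k (h s) - p i k 0) * p k j (m s)) / h s"
      by (simp add: q_def sum_divide_distrib)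
    ultimately have "\<bar>(p i j s - p i j t) / (s - t) - q s\<bar>
        = \<bar>p i j (h s + m s) - p i j (m s) - (\<Sum>k\<in>nbhd i. (p i k (h s) - p i k 0) * p k j (m s))\<bar> / h s"
      using hm by (simp add: diff_divide_distrib[symmetric] abs_divide)
    also have "\<dots> \<le> escape i (h s) / h s"
      using hm by (intro divide_right_mono first_step) auto
    finally show ?thesis by (simp add: escape_zero)
  qed
  have "((\<lambda>s. (p i j s - p i j t) / (s - t) - q s) \<longlongrightarrow> 0) (at t within {0..})"
    by (rule Lim_null_comparison[OF _ e]) (use bnd in \<open>auto simp: eventually_at_filter intro!: always_eventually\<close>)
  from tendsto_add[OF this q] show ?thesis by (simp add: has_field_derivative_iff)
qed

lemma backward_within:
  "0 \<le> t \<Longrightarrow> S \<subseteq> {0..} \<Longrightarrow>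
    (p i j has_real_derivative bd_generator b d (\<lambda>k. p k j t) i) (at t within S)"
  using backward DERIV_subset by blast

lemma p_absorbed:
  assumes "0 \<le> t" shows "p 0 j t = (if j = 0 then 1 else 0)"
proof -
  have "(p 0 j has_real_derivative 0) (at s within {0..})" if "s \<in> {0..}" for s
    using backward[of s 0 j] that by (simp add: bd_generator_def)
  then obtain c where "\<And>s. s \<in> {0..} \<Longrightarrow> p 0 j s = c"
    using has_field_derivative_zero_constant[of "{0..}" "p 0 j"] by auto
  then have "p 0 j t = p 0 j 0" using assms by auto
  then show ?thesis by (simp add: p_zero)
qed

end

section \<open>Comparison and monotonicity\<close>

context birth_death_semigroup
begin

text \<open>\<open>V\<close> is the scale function (harmonic for the generator), \<open>w\<close> the reversible measure,
  which is of interest from index \<open>1\<close> on.\<close>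

definition V :: "nat \<Rightarrow> real" where "V n = (\<Sum>m<n. \<Prod>k=1..m. d k / b k)"

definition w :: "nat \<Rightarrow> real" where "w n = (\<Prod>k=1..<n. b k / d (Suc k))"

lemma V_0 [simp]: "V 0 = 0" and V_1 [simp]: "V (Suc 0) = 1"
  by (simp_all add: V_def)

lemma V_increment_pos: "0 < (\<Prod>k=1..m. d k / b k)"
  by (intro prod_pos divide_pos_pos) (auto intro: b_pos d_pos)

lemma V_nonneg: "0 \<le> V n"
  unfolding V_def by (intro sum_nonneg less_imp_le V_increment_pos)

lemma V_mono: "m \<le> n \<Longrightarrow> V m \<le> V n"
  unfolding V_def by (intro sum_mono2 less_imp_le[OF V_increment_pos]) auto

lemma generator_V: "bd_generator b d V i = 0"
proof (cases i)
  case (Suc n)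
  have "V (Suc (Suc n)) - V (Suc n) = (V (Suc n) - V n) * (d (Suc n) / b (Suc n))"
    by (simp add: V_def)
  moreover have "0 < b (Suc n)" by (simp add: b_pos)
  ultimately show ?thesis by (simp add: Suc bd_generator_def field_simps)
qed (simp add: bd_generator_def)

lemma V_at_top: "filterlim V at_top sequentially"
proof -
  have "V (N + 1) = 1 + (\<Sum>n=1..N. (\<Prod>k=1..n. d k) / (\<Prod>k=1..n. b k))" for N
  proof -
    have "V (N + 1) = (\<Sum>m=0..N. \<Prod>k=1..m. d k / b k)"
      unfolding V_def by (intro sum.cong) auto
    also have "\<dots> = 1 + (\<Sum>n=1..N. \<Prod>k=1..n. d k / b k)"
      by (subst sum.atLeast_Suc_atMost) auto
    finally show ?thesis by (simp add: prod_dividef)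
  qed
  then have "filterlim (\<lambda>N. V (N + 1)) at_top sequentially"
    using filterlim_tendsto_add_at_top[OF tendsto_const[of 1] recurrent] by simp
  then show ?thesis using filterlim_sequentially_Suc[of V at_top] by simp
qed

lemma V_sublevel_finite: "finite {n. V n \<le> c}"
proof -
  obtain N where "\<And>n. N \<le> n \<Longrightarrow> c + 1 \<le> V n"
    using V_at_top by (auto simp: filterlim_at_top eventually_sequentially)
  then have "{n. V n \<le> c} \<subseteq> {..<N}" by (force simp: not_le[symmetric])
  then show ?thesis using finite_subset by blast
qed

lemma w_pos: "0 < w n"
  unfolding w_def by (intro prod_pos divide_pos_pos) (auto intro: b_pos d_pos)

lemma w_1 [simp]: "w (Suc 0) = 1"
  by (simp add: w_def)

lemma detailed_balance: "1 \<le> n \<Longrightarrow> w (Suc n) * d (Suc n) = w n * b n"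
  using d_pos[of "Suc n"] by (simp add: w_def)

text \<open>In network terms, \<open>V (Suc n) - V n\<close> is \<open>d 1\<close> times the
  resistance of the edge from \<open>n\<close> to \<open>n + 1\<close>. Weighting by these
  increments removes the factor \<open>w n * b n\<close> of the boundary term in Green's
  formula.\<close>

lemma V_increment: "1 \<le> n \<Longrightarrow> (V (Suc n) - V n) * (w n * b n) = d 1"
proof (induction n rule: nat_induct_at_least)
  case base
  show ?case using b_pos[of 1] by (simp add: V_def)
next
  case (Suc n)
  have "V (Suc (Suc n)) - V (Suc n) = (V (Suc n) - V n) * (d (Suc n) / b (Suc n))"
    by (simp add: V_def)
  then have "(V (Suc (Suc n)) - V (Suc n)) * (w (Suc n) * b (Suc n)) = (V (Suc n) - V n) * (w (Suc n) * d (Suc n))"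
    using b_pos[of "Suc n"] by simp
  then show ?case using Suc detailed_balance by simp
qed

text \<open>The penalty \<open>e * (V i + 1 + t)\<close> makes the difference nonpositive outside
  the finite set where \<open>V\<close> is at most \<open>B / e\<close>. At a positive maximum the
  generator of the penalised function is nonpositive, the harmonic \<open>V\<close> contributes
  nothing, and the term \<open>e * t\<close> makes the time derivative strictly negative. Then
  \<open>e\<close> tends to 0. The boundary condition at 0 is hidden in \<open>ineq\<close>: where
  \<open>u\<close> is positive, the state is at least 1.\<close>

lemma comparison:
  assumes bdd: "\<And>i t. 0 \<le> t \<Longrightarrow> t \<le> T \<Longrightarrow> u i t \<le> B"
    and der: "\<And>i t. 0 \<le> t \<Longrightarrow> t \<le> T \<Longrightarrow> (u i has_real_derivative u' i t) (at t within {0..T})"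
    and ineq: "\<And>i t. 0 \<le> t \<Longrightarrow> t \<le> T \<Longrightarrow> 0 < u i t \<Longrightarrow>
      1 \<le> i \<and> u' i t \<le> bd_generator b d (\<lambda>k. u k t) i"
    and init: "\<And>i. u i 0 \<le> 0"
    and t: "0 \<le> t" "t \<le> T"
  shows "u i t \<le> 0"
proof -
  have eps: "u i t \<le> e * (V i + 1 + t)" if e: "0 < e" for e
  proof -
    define v where "v i t = u i t - e * (V i + 1 + t)" for i t
    have "v i t \<le> 0"
    proof (rule parabolic_maximum_principle[where w = v and K = "{n. V n \<le> B / e}" and w' = "\<lambda>i t. u' i t - e" and T = T])
      fix a t assume at: "a \<notin> {n. V n \<le> B / e}" "0 \<le> t" "t \<le> T"
      then have "B < e * V a" using e by (simp add: field_simps not_le)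
      moreover have "0 \<le> e * (1 + t)" using e at by simp
      ultimately show "v a t \<le> 0" using bdd[OF at(2,3), of a] by (simp add: v_def algebra_simps)
    next
      fix a t assume at: "0 \<le> t" "t \<le> T"
      show "(v a has_real_derivative u' a t - e) (at t within {0..T})"
        unfolding v_def[abs_def] by (auto intro!: derivative_eq_intros der at)
    next
      fix a show "v a 0 \<le> 0"
        using init[of a] e V_nonneg[of a] by (auto simp: v_def intro: order.trans)
    next
      fix a t assume at: "0 < t" "t \<le> T" "0 < v a t" "\<And>c. v c t \<le> v a t"
      have "0 \<le> e * (V a + 1 + t)" using e V_nonneg[of a] at by simp
      then have "0 < u a t" using at(3) by (simp add: v_def)
      with ineq[of t a] at have a: "1 \<le> a" and u': "u' a t \<le> bd_generator b d (\<lambda>k. u k t) a" by auto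
      have "bd_generator b d (\<lambda>k. u k t) a
          = bd_generator b d (\<lambda>k. v k t) a + e * bd_generator b d V a"
        using a by (simp add: bd_generator_def v_def algebra_simps)
      also have "\<dots> \<le> 0"
        using a b_pos[OF a] d_pos[OF a] at(4)
        unfolding generator_V by (auto simp: bd_generator_def intro!: add_nonpos_nonpos mult_nonneg_nonpos)
      finally show "u' a t - e < 0" using u' e by simp
    qed (use t V_sublevel_finite in auto)
    then show ?thesis by (simp add: v_def)
  qed
  show ?thesis
  proof (rule field_le_epsilon)
    fix e :: real assume e: "0 < e"
    have pos: "0 < V i + 1 + t" using V_nonneg[of i] t by simp
    then have "u i t \<le> e / (V i + 1 + t) * (V i + 1 + t)" using e by (intro eps) simp
    then show "u i t \<le> 0 + e" using pos by simp
  qed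
qed

lemma backward_unique:
  assumes bdd: "\<And>i t. 0 \<le> t \<Longrightarrow> t \<le> T \<Longrightarrow> \<bar>u i t\<bar> \<le> B"
    and der: "\<And>i t. 0 \<le> t \<Longrightarrow> t \<le> T \<Longrightarrow>
      (u i has_real_derivative bd_generator b d (\<lambda>k. u k t) i) (at t within {0..T})"
    and absorbed: "\<And>t. 0 \<le> t \<Longrightarrow> t \<le> T \<Longrightarrow> u 0 t = 0"
    and init: "\<And>i. u i 0 = 0"
    and t: "0 \<le> t" "t \<le> T"
  shows "u i t = 0"
proof (rule antisym)
  have pos: "1 \<le> j" if "0 \<le> s" "s \<le> T" "u j s \<noteq> 0" for j s
    using absorbed[OF that(1,2)] that(3) by (cases j) auto
  show "u i t \<le> 0"
    using bdd init by (intro comparison[OF _ der _ _ t, where B = B] conjI order.refl pos) (auto simp: abs_le_iff)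
  have "- u i t \<le> 0"
  proof (rule comparison[OF _ _ _ _ t, where B = B and u = "\<lambda>i t. - u i t"
        and u' = "\<lambda>i t. - bd_generator b d (\<lambda>k. u k t) i"])
    show "((\<lambda>t. - u j t) has_real_derivative - bd_generator b d (\<lambda>k. u k s) j) (at s within {0..T})"
      if "0 \<le> s" "s \<le> T" for j s using that by (intro DERIV_minus der)
    show "1 \<le> j \<and> - bd_generator b d (\<lambda>k. u k s) j \<le> bd_generator b d (\<lambda>k. - u k s) j"
      if "0 \<le> s" "s \<le> T" "0 < - u j s" for j s
      using pos[of s j] that by (simp add: bd_generator_def algebra_simps)
  qed (use bdd init in \<open>auto simp: abs_le_iff\<close>)
  then show "0 \<le> u i t" by simp
qed

section \<open>Monotone dependence on the starting state\<close>

definition cdf :: "nat \<Rightarrow> nat \<Rightarrow> real \<Rightarrow> real" where "cdf m k t = (\<Sum>j\<le>m. p k j t)"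

text \<open>The difference of two starting points is controlled by the maximum principle on pairs of
  states, that is for two independent copies of the process up to their meeting time.\<close>

lemma cdf_antimono:
  assumes "k \<le> l" "0 \<le> t"
  shows "cdf m l t \<le> cdf m k t"
proof -
  have eps: "cdf m l t - cdf m k t \<le> e * (V l + V k + 1 + t)" if e: "0 < e" for e
  proof -
    define v where "v a t = (if fst a \<le> snd a
      then cdf m (snd a) t - cdf m (fst a) t - e * (V (snd a) + V (fst a) + 1 + t) else 0)"
      for a :: "nat \<times> nat" and t
    define G where "G k t = bd_generator b d (\<lambda>k. cdf m k t) k" for k t
    have der: "(cdf m k has_real_derivative G k s) (at s within {0..t})" if "0 \<le> s" for k s
      unfolding cdf_def[abs_def] G_def bd_generator_sum
      using that by (intro DERIV_sum backward_within) auto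
    have c01: "0 \<le> cdf m k s" "cdf m k s \<le> 1" if "0 \<le> s" for k s
      using that by (auto simp: cdf_def intro!: sum_nonneg p_nonneg sum_p_le_1)
    have c0: "cdf m 0 s = 1" if "0 \<le> s" for s
      using that by (simp add: cdf_def p_absorbed)
    let ?K = "{a \<in> {n. V n \<le> 1 / e} \<times> {n. V n \<le> 1 / e}. fst a \<le> snd a}"
    have "v (k, l) t \<le> 0"
    proof (rule parabolic_maximum_principle[where w = v and K = ?K and w' = "\<lambda>a t. G (snd a) t - G (fst a) t - e" and T = t])
      fix a :: "nat \<times> nat" and s assume a: "a \<notin> ?K" "0 \<le> s" "s \<le> t"
      obtain x y where [simp]: "a = (x, y)" by (cases a)
      show "v a s \<le> 0"
      proof (cases "x \<le> y")
        case True
        with a have "1 < e * V y \<or> 1 < e * V x" using e by (auto simp: field_simps not_le)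
        moreover have "0 \<le> e * V x" "0 \<le> e * V y" "0 \<le> e * (1 + s)" using e V_nonneg a by auto
        ultimately show ?thesis
          using c01[OF a(2), of y] c01[OF a(2), of x] True by (auto simp: v_def algebra_simps)
      qed (simp add: v_def)
    next
      fix a s assume a: "a \<in> ?K" and s: "0 \<le> s" "s \<le> t"
      have "((\<lambda>t. cdf m (snd a) t - cdf m (fst a) t - e * (V (snd a) + V (fst a) + 1 + t))
          has_real_derivative G (snd a) s - G (fst a) s - e) (at s within {0..t})"
        by (auto intro!: derivative_eq_intros der s)
      then show "(v a has_real_derivative G (snd a) s - G (fst a) s - e) (at s within {0..t})"
        using a by (simp add: v_def[abs_def])
    next
      fix a assume a: "a \<in> ?K"
      then have "cdf m (snd a) 0 \<le> cdf m (fst a) 0"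
        by (auto simp: cdf_def p_zero)
      moreover have "0 \<le> e * (V (snd a) + V (fst a) + 1)" using e V_nonneg by simp
      ultimately show "v a 0 \<le> 0" by (auto simp: v_def)
    next
      fix a s assume a: "a \<in> ?K" and s: "0 < s" "s \<le> t" and pos: "0 < v a s" and max: "\<And>c. v c s \<le> v a s"
      obtain x y where [simp]: "a = (x, y)" by (cases a)
      have "0 \<le> e * (V y + V x + 1 + s)" using e V_nonneg s by simp
      with pos a have less: "cdf m x s < cdf m y s" by (auto simp: v_def)
      with a have xy: "x < y" by (auto simp: le_less)
      have x: "1 \<le> x" using less c0[of s] c01[of s y] s by (cases x) auto
      \<comment> \<open>At a positive maximum the two starting states differ, so all four
        neighbouring pairs are still ordered and fall under the first branch of \<open>v\<close>.
        Maximality there gives one inequality for each jump; weighted by the rates, they add up to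
        the generators of \<open>cdf m\<close> and \<open>V\<close>.\<close>
      have ord: "x \<le> y" "x \<le> y + 1" "x \<le> y - 1" "x + 1 \<le> y" "x - 1 \<le> y" using xy by auto
      have up: "cdf m (y + 1) s - cdf m y s \<le> e * (V (y + 1) - V y)"
        and dn: "cdf m (y - 1) s - cdf m y s \<le> e * (V (y - 1) - V y)"
        and up': "cdf m x s - cdf m (x + 1) s \<le> e * (V (x + 1) - V x)"
        and dn': "cdf m x s - cdf m (x - 1) s \<le> e * (V (x - 1) - V x)"
        using max[of "(x, y + 1)"] max[of "(x, y - 1)"] max[of "(x + 1, y)"] max[of "(x - 1, y)"]
        by (simp_all only: v_def ord fst_conv snd_conv if_True \<open>a = (x, y)\<close>) (simp_all add: algebra_simps)
      have y: "1 \<le> y" using xy by simp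
      have "G y s \<le> e * bd_generator b d V y"
        using mult_left_mono[OF up less_imp_le[OF b_pos[OF y]]] mult_left_mono[OF dn less_imp_le[OF d_pos[OF y]]] y
        by (simp add: G_def bd_generator_def algebra_simps)
      moreover have "- G x s \<le> e * bd_generator b d V x"
        using mult_left_mono[OF up' less_imp_le[OF b_pos[OF x]]] mult_left_mono[OF dn' less_imp_le[OF d_pos[OF x]]] x
        by (simp add: G_def bd_generator_def algebra_simps)
      ultimately show "G (snd a) s - G (fst a) s - e < 0" using e by (simp add: generator_V)
    qed (use assms V_sublevel_finite in \<open>auto intro: finite_subset\<close>)
    then show ?thesis using assms by (simp add: v_def)
  qed
  have "cdf m l t - cdf m k t \<le> 0"
  proof (rule field_le_epsilon)
    fix e :: real assume e: "0 < e"
    have pos: "0 < V l + V k + 1 + t" using V_nonneg[of l] V_nonneg[of k] assms by simp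
    then have "cdf m l t - cdf m k t \<le> e / (V l + V k + 1 + t) * (V l + V k + 1 + t)" using e by (intro eps) simp
    then show "cdf m l t - cdf m k t \<le> 0 + e" using pos by simp
  qed
  then show ?thesis by simp
qed

text \<open>As a function of the starting state, \<open>p n i t\<close> is the difference of two
  antitone functions with values in \<open>{0..1}\<close>, and each of them contributes at most 1 to
  the variation.\<close>

lemma p_bounded_variation:
  assumes t: "0 \<le> t" and i: "1 \<le> i"
  shows "(\<Sum>n=M..<N. \<bar>p (Suc n) i t - p n i t\<bar>) \<le> 2"
proof (cases "M \<le> N")
  case True
  obtain i' where i': "i = Suc i'" using i by (cases i) auto
  have p: "p n i t = cdf i n t - cdf i' n t" for n by (simp add: cdf_def i')
  have "(\<Sum>n=M..<N. \<bar>p (Suc n) i t - p n i t\<bar>)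
      \<le> (\<Sum>n=M..<N. (- cdf i (Suc n) t - - cdf i n t) + (- cdf i' (Suc n) t - - cdf i' n t))"
    using cdf_antimono[OF _ t, of _ "Suc _"] unfolding p by (intro sum_mono) (fastforce simp: abs_le_iff)
  also have "\<dots> = (cdf i M t - cdf i N t) + (cdf i' M t - cdf i' N t)"
    unfolding sum.distrib using True by (subst (1 2) sum_Suc_diff') auto
  also have "\<dots> \<le> 2"
  proof -
    have "0 \<le> cdf m k t" "cdf m k t \<le> 1" for m k
      using t by (auto simp: cdf_def intro!: sum_nonneg p_nonneg sum_p_le_1)
    from this(2)[of i M] this(2)[of i' M] this(1)[of i N] this(1)[of i' N] show ?thesis by simp
  qed
  finally show ?thesis .
qed simp

end

section \<open>Reversibility and absorption\<close>

lemma bd_generator_derivative: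
  assumes "\<And>k. (f k has_real_derivative f' k) (at x within S)"
  shows "((\<lambda>s. bd_generator b d (\<lambda>k. f k s) i) has_real_derivative bd_generator b d f' i) (at x within S)"
proof (cases "i = 0")
  case False
  have "((\<lambda>s. b i * (f (i + 1) s - f i s) + d i * (f (i - 1) s - f i s)) has_real_derivative
      b i * (f' (i + 1) - f' i) + d i * (f' (i - 1) - f' i)) (at x within S)"
    by (intro DERIV_add DERIV_cmult DERIV_diff assms)
  then show ?thesis using False by (simp add: bd_generator_def)
qed (simp add: bd_generator_def)

lemma bd_generator_tendsto:
  assumes "\<And>k. (f k \<longlongrightarrow> g k) F"
  shows "((\<lambda>s. bd_generator b d (\<lambda>k. f k s) i) \<longlongrightarrow> bd_generator b d g i) F"
  by (cases "i = 0") (auto simp: bd_generator_def intro!: tendsto_intros assms)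

context birth_death_semigroup
begin

text \<open>The eigenvalue equation at \<open>Suc k\<close> is a three-term recurrence that
  determines the value at \<open>Suc (Suc k)\<close>, because \<open>b (Suc k)\<close> is positive.
  The value 0 at the absorbing state leaves one free parameter, the value at 1.\<close>

lemma eigenvector_unique:
  assumes f: "\<And>k. 1 \<le> k \<Longrightarrow> bd_generator b d f k = - x * f k"
    and g: "\<And>k. 1 \<le> k \<Longrightarrow> bd_generator b d g k = - x * g k"
    and "f 0 = 0" "g 0 = 0" "g 1 = 1"
  shows "f n = f 1 * g n"
proof (induction n rule: less_induct)
  case (less n)
  consider "n = 0" | "n = 1" | k where "n = Suc (Suc k)" by (metis One_nat_def not0_implies_Suc)
  then show ?case
  proof cases
    case 3
    let ?h = "\<lambda>k. f k - f 1 * g k"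
    have "bd_generator b d ?h (Suc k) = - x * ?h (Suc k)"
      unfolding bd_generator_diff bd_generator_cmult using f[of "Suc k"] g[of "Suc k"]
      by (simp add: algebra_simps)
    moreover have "?h (Suc k) = 0" "?h k = 0" using less[of "Suc k"] less[of k] 3 by auto
    ultimately have "b (Suc k) * ?h n = 0"
      by (simp add: bd_generator_def 3)
    then show ?thesis using b_pos[of "Suc k"] by simp
  qed (use assms in auto)
qed

lemma green:
  assumes "u 0 = 0" "v 0 = 0"
  shows "(\<Sum>k=1..N. w k * (bd_generator b d u k * v k - u k * bd_generator b d v k))
    = w N * b N * (u (Suc N) * v N - u N * v (Suc N))"
proof (induction N)
  case (Suc N)
  \<comment> \<open>Detailed balance makes the flux leaving the first \<open>N\<close> states cancel
    the one entering state \<open>Suc N\<close>. For \<open>N = 0\<close> both sides vanish by the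
    boundary values of \<open>u\<close> and \<open>v\<close>.\<close>
  have flux: "w (Suc N) * d (Suc N) * (u N * v (Suc N) - u (Suc N) * v N)
      = - (w N * b N * (u (Suc N) * v N - u N * v (Suc N)))"
    using detailed_balance[of N] assms by (cases "N = 0") (auto simp: algebra_simps)
  have "(\<Sum>k=1..Suc N. w k * (bd_generator b d u k * v k - u k * bd_generator b d v k))
      = w N * b N * (u (Suc N) * v N - u N * v (Suc N))
        + w (Suc N) * (bd_generator b d u (Suc N) * v (Suc N) - u (Suc N) * bd_generator b d v (Suc N))"
    using Suc by simp
  also have "w (Suc N) * (bd_generator b d u (Suc N) * v (Suc N) - u (Suc N) * bd_generator b d v (Suc N))
      = w (Suc N) * b (Suc N) * (u (Suc (Suc N)) * v (Suc N) - u (Suc N) * v (Suc (Suc N)))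
        + w (Suc N) * d (Suc N) * (u N * v (Suc N) - u (Suc N) * v N)"
    by (simp add: bd_generator_def algebra_simps)
  finally show ?case unfolding flux by simp
qed (simp add: b0)

text \<open>By Green's formula the defect \<open>D\<close> of symmetry equals, for every large \<open>N\<close>, the time
  integral of a boundary term at \<open>N\<close>. Divided by \<open>w N * b N\<close>, the boundary terms have a bounded
  sum over \<open>N\<close>, whereas the sum of \<open>1 / (w N * b N)\<close> diverges.\<close>

lemma reversible:
  assumes i: "1 \<le> i" and j: "1 \<le> j" and T: "0 \<le> T"
  shows "w i * p i j T = w j * p j i T"
proof -
  \<comment> \<open>\<open>G N\<close> interpolates between the two sides of the claim: it starts at
    \<open>w i * p i j T\<close> and ends at \<open>w j * p j i T\<close>, once \<open>N\<close> is
    at least \<open>M0\<close>. Its derivative is only the boundary term at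
    \<open>N\<close>.\<close>
  define G where "G N s = (\<Sum>k=1..N. w k * (p k i s * p k j (T - s)))" for N s
  define M0 where "M0 = max i j"
  \<comment> \<open>The scale weights turn each boundary term into \<open>d 1 * B N s\<close>, which
    has a bounded sum, while the total weight \<open>V M - V M0\<close> is unbounded.\<close>
  define H where "H M s = (\<Sum>N=M0..<M. (V (Suc N) - V N) * G N s)" for M s
  define B where "B N s = p (Suc N) i s * p N j (T - s) - p N i s * p (Suc N) j (T - s)" for N s
  define D where "D = w j * p j i T - w i * p i j T"
  have derG: "(G N has_real_derivative w N * b N * B N s) (at s within {0..T})" if s: "0 \<le> s" "s \<le> T" for N s
  proof -
    have r: "((\<lambda>s. p k j (T - s)) has_real_derivative - bd_generator b d (\<lambda>k. p k j (T - s)) k) (at s within {0..T})" for k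
    proof -
      have "((\<lambda>s. T - s) has_real_derivative - 1) (at s within {0..T})"
        by (auto intro!: derivative_eq_intros)
      moreover have "(p k j has_real_derivative bd_generator b d (\<lambda>k. p k j (T - s)) k)
          (at (T - s) within (\<lambda>s. T - s) ` {0..T})"
        using s by (intro backward_within) auto
      ultimately show ?thesis using DERIV_image_chain by (fastforce simp: o_def)
    qed
    have "(G N has_real_derivative (\<Sum>k=1..N. w k * (bd_generator b d (\<lambda>k. p k i s) k * p k j (T - s)
        - p k i s * bd_generator b d (\<lambda>k. p k j (T - s)) k))) (at s within {0..T})"
      unfolding G_def[abs_def] using s
      by (intro DERIV_sum) (auto intro!: derivative_eq_intros r backward_within)
    also have "(\<Sum>k=1..N. w k * (bd_generator b d (\<lambda>k. p k i s) k * p k j (T - s)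
        - p k i s * bd_generator b d (\<lambda>k. p k j (T - s)) k)) = w N * b N * B N s"
      unfolding B_def by (rule green) (use s i j in \<open>auto simp: p_absorbed\<close>)
    finally show ?thesis .
  qed
  have N1: "1 \<le> N" if "N \<in> {M0..<M}" for N M using that i by (auto simp: M0_def)
  have derH: "(H M has_real_derivative (\<Sum>N=M0..<M. d 1 * B N s)) (at s within {0..T})"
    if s: "0 \<le> s" "s \<le> T" for M s
  proof -
    have "(H M has_real_derivative (\<Sum>N=M0..<M. (V (Suc N) - V N) * (w N * b N * B N s))) (at s within {0..T})"
      unfolding H_def[abs_def] by (intro DERIV_sum DERIV_cmult derG s)
    moreover have "(V (Suc N) - V N) * (w N * b N * B N s) = d 1 * B N s" if "N \<in> {M0..<M}" for N
      using V_increment[OF N1[OF that]] by (simp add: mult.assoc[symmetric])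
    ultimately show ?thesis by simp
  qed
  have bnd: "\<bar>\<Sum>N=M0..<M. d 1 * B N s\<bar> \<le> d 1 * 4" if s: "0 \<le> s" "s \<le> T" for M s
  proof -
    have "\<bar>B N s\<bar> \<le> \<bar>p (Suc N) i s - p N i s\<bar> + \<bar>p (Suc N) j (T - s) - p N j (T - s)\<bar>" for N
    proof -
      have "B N s = (p (Suc N) i s - p N i s) * p N j (T - s) - p N i s * (p (Suc N) j (T - s) - p N j (T - s))"
        by (simp add: B_def algebra_simps)
      also have "\<bar>\<dots>\<bar> \<le> \<bar>(p (Suc N) i s - p N i s) * p N j (T - s)\<bar> + \<bar>p N i s * (p (Suc N) j (T - s) - p N j (T - s))\<bar>"
        by (rule abs_triangle_ineq4)
      also have "\<dots> \<le> \<bar>p (Suc N) i s - p N i s\<bar> + \<bar>p (Suc N) j (T - s) - p N j (T - s)\<bar>"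
        using s by (intro add_mono) (auto simp: abs_mult p_nonneg p_le_1 mult_left_le mult_left_le_one_le)
      finally show ?thesis .
    qed
    then have "(\<Sum>N=M0..<M. \<bar>B N s\<bar>) \<le> (\<Sum>N=M0..<M. \<bar>p (Suc N) i s - p N i s\<bar> + \<bar>p (Suc N) j (T - s) - p N j (T - s)\<bar>)"
      by (intro sum_mono)
    also have "\<dots> \<le> 2 + 2"
      unfolding sum.distrib using s by (intro add_mono p_bounded_variation i j) auto
    finally have "\<bar>\<Sum>N=M0..<M. B N s\<bar> \<le> 4" using sum_abs[of "\<lambda>N. B N s" "{M0..<M}"] by linarith
    then show ?thesis using d_pos[of 1] by (simp add: sum_distrib_left[symmetric] abs_mult)
  qed
  have G_end: "G N T = w j * p j i T" "G N 0 = w i * p i j T" if "M0 \<le> N" for N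
  proof -
    have "G N T = (\<Sum>k=1..N. if k = j then w j * p j i T else 0)"
      unfolding G_def by (intro sum.cong) (auto simp: p_zero)
    then show "G N T = w j * p j i T" using that j by (simp add: M0_def)
    have "G N 0 = (\<Sum>k=1..N. if k = i then w i * p i j T else 0)"
      unfolding G_def by (intro sum.cong) (auto simp: p_zero)
    then show "G N 0 = w i * p i j T" using that i by (simp add: M0_def)
  qed
  have key: "\<bar>D\<bar> * (V M - V M0) \<le> d 1 * 4 * T" if "M0 \<le> M" for M
  proof -
    have "H M T - H M 0 = (\<Sum>N=M0..<M. (V (Suc N) - V N) * D)"
      unfolding H_def sum_subtractf[symmetric] by (intro sum.cong) (auto simp: G_end D_def algebra_simps)
    also have "\<dots> = D * (V M - V M0)"
      using that by (simp add: sum_distrib_right[symmetric] sum_Suc_diff')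
    finally have "H M T - H M 0 = D * (V M - V M0)" .
    moreover have "norm (H M T - H M 0) \<le> d 1 * 4 * norm (T - 0)"
      using T by (intro field_differentiable_bound[where S = "{0..T}" and f' = "\<lambda>s. \<Sum>N=M0..<M. d 1 * B N s"])
        (auto intro!: derH bnd simp del: One_nat_def)
    ultimately show ?thesis using T V_mono[OF that] by (simp add: abs_mult)
  qed
  have "D = 0"
  proof (rule ccontr)
    assume "D \<noteq> 0"
    have "eventually (\<lambda>M. d 1 * 4 * T / \<bar>D\<bar> + V M0 + 1 \<le> V M \<and> M0 \<le> M) sequentially"
      using V_at_top by (intro eventually_conj eventually_ge_at_top) (auto simp: filterlim_at_top)
    then obtain M where M: "d 1 * 4 * T / \<bar>D\<bar> + V M0 + 1 \<le> V M" "M0 \<le> M"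
      by (auto simp: eventually_sequentially)
    then have "d 1 * 4 * T / \<bar>D\<bar> < V M - V M0" by simp
    then have "d 1 * 4 * T < \<bar>D\<bar> * (V M - V M0)" using \<open>D \<noteq> 0\<close> by (simp add: field_simps)
    with key[OF M(2)] show False by simp
  qed
  then show ?thesis by (simp add: D_def)
qed

text \<open>This is the forward equation at state 0. The time integral \<open>v\<close> of
  \<open>p k 1\<close> satisfies \<open>bd_generator b d v = p k 1 s - p k 1 0\<close>, so
  \<open>p k 0\<close> and \<open>d 1 * v k\<close> solve the same backward problem on the states
  from 1 on, and uniqueness identifies them.\<close>

lemma absorption_density:
  assumes "0 \<le> t"
  shows "(p i 0 has_real_derivative d 1 * p i 1 t) (at t within {0..})"
proof -
  define v where "v k s = integral {0..s} (p k 1)" for k s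
  have v_der: "(v k has_real_derivative p k 1 s) (at s within {0..T})" if "0 \<le> s" "s \<le> T" for k s T
    unfolding v_def using that
    by (intro integral_has_real_derivative continuous_on_subset[OF p_continuous]) auto
  have v_zero: "v k 0 = 0" for k by (simp add: v_def)
  have v_bound: "\<bar>v k s\<bar> \<le> s" if "0 \<le> s" for k s
  proof -
    have "norm (v k s - v k 0) \<le> 1 * norm (s - 0)"
      using that by (intro field_differentiable_bound[where S = "{0..s}" and f' = "\<lambda>s. p k 1 s"])
        (auto intro!: v_der p_le_1 simp: p_nonneg simp del: One_nat_def)
    then show ?thesis using that by (simp add: v_zero)
  qed
  have v_absorbed: "v 0 s = 0" if "0 \<le> s" for s
  proof -
    have "v 0 s = integral {0..s} (\<lambda>_. 0)"
      unfolding v_def by (intro integral_cong) (simp add: p_absorbed)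
    then show ?thesis by simp
  qed
  have v_gen: "bd_generator b d (\<lambda>k. v k s) k = p k 1 s - p k 1 0" if "0 \<le> s" for k s
  proof -
    define f where "f r = bd_generator b d (\<lambda>k. v k r) k - p k 1 r" for r
    have "(f has_real_derivative 0) (at r within {0..s})" if "r \<in> {0..s}" for r
    proof -
      have "(f has_real_derivative bd_generator b d (\<lambda>k. p k 1 r) k - bd_generator b d (\<lambda>k. p k 1 r) k)
          (at r within {0..s})"
        unfolding f_def[abs_def] using that
        by (intro DERIV_diff bd_generator_derivative v_der backward_within) auto
      then show ?thesis by simp
    qed
    then obtain c where "\<And>r. r \<in> {0..s} \<Longrightarrow> f r = c"
      using has_field_derivative_zero_constant[of "{0..s}" f] by auto
    then have "f s = f 0" using that by auto
    then have "bd_generator b d (\<lambda>k. v k s) k - p k 1 s = bd_generator b d (\<lambda>k. v k 0) k - p k 1 0"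
      by (simp only: f_def)
    moreover have "bd_generator b d (\<lambda>k. v k 0) k = 0" by (simp add: bd_generator_def v_zero)
    ultimately show ?thesis by simp
  qed
  have eq: "p k 0 s = d 1 * v k s" if k: "1 \<le> k" and s: "0 \<le> s" for k s
  proof -
    \<comment> \<open>At state 0 the two functions differ, since \<open>p 0 0 = 1\<close>. Setting
      \<open>u 0 = 0\<close> costs a term \<open>d 1\<close> in the generator at state 1, which the
      term \<open>p k 1 0\<close> in \<open>v_gen\<close> compensates exactly.\<close>
    define u where "u k s = (if k = 0 then 0 else p k 0 s - d 1 * v k s)" for k s
    have "u k s = 0"
    proof (rule backward_unique[where u = u and T = s and B = "1 + d 1 * s"])
      fix k r assume r: "0 \<le> r" "r \<le> s"
      have "\<bar>p k 0 r - d 1 * v k r\<bar> \<le> \<bar>p k 0 r\<bar> + \<bar>d 1 * v k r\<bar>" by (rule abs_triangle_ineq4)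
      also have "\<dots> \<le> 1 + d 1 * s"
        unfolding abs_mult using r d_pos[of 1] v_bound[of r k]
        by (intro add_mono mult_mono) (auto simp: p_nonneg p_le_1)
      finally show "\<bar>u k r\<bar> \<le> 1 + d 1 * s" using r s d_pos[of 1] by (auto simp: u_def)
      show "(u k has_real_derivative bd_generator b d (\<lambda>k. u k r) k) (at r within {0..s})"
      proof (cases "k = 0")
        case True
        then show ?thesis by (simp add: u_def[abs_def] bd_generator_def)
      next
        case False
        have "((\<lambda>s. p k 0 s - d 1 * v k s) has_real_derivative
            bd_generator b d (\<lambda>k. p k 0 r) k - d 1 * p k 1 r) (at r within {0..s})"
          using r by (intro DERIV_diff DERIV_cmult v_der backward_within) auto
        moreover have "bd_generator b d (\<lambda>k. u k r) k
            = bd_generator b d (\<lambda>k. p k 0 r) k - d 1 * bd_generator b d (\<lambda>k. v k r) k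
              - (if k = 1 then d 1 else 0)"
          using False r by (auto simp: bd_generator_def u_def p_absorbed v_absorbed algebra_simps)
        then have "bd_generator b d (\<lambda>k. u k r) k = bd_generator b d (\<lambda>k. p k 0 r) k - d 1 * p k 1 r"
          unfolding v_gen[OF r(1)] by (auto simp: p_zero algebra_simps split: if_splits)
        moreover have "u k = (\<lambda>s. p k 0 s - d 1 * v k s)" using False by (auto simp: u_def)
        ultimately show ?thesis by (simp only:)
      qed
    qed (use s in \<open>auto simp: u_def v_zero p_zero\<close>)
    then show ?thesis using k by (simp add: u_def)
  qed
  show ?thesis
  proof (cases "i = 0")
    case True
    then show ?thesis using backward[OF assms, of 0 0] assms
      by (simp add: bd_generator_def p_absorbed)
  next
    case False
    have "bd_generator b d (\<lambda>k. p k 0 t) i = bd_generator b d (\<lambda>k. d 1 * v k t + (if k = 0 then 1 else 0)) i"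
      using False assms by (auto simp: bd_generator_def eq p_absorbed v_absorbed)
    also have "\<dots> = d 1 * bd_generator b d (\<lambda>k. v k t) i + (if i = 1 then d 1 else 0)"
      using False by (auto simp: bd_generator_def algebra_simps)
    also have "\<dots> = d 1 * p i 1 t"
      unfolding v_gen[OF assms] by (auto simp: p_zero algebra_simps)
    finally show ?thesis using backward[OF assms] by metis
  qed
qed

lemma p_absorbing_mono:
  assumes "0 \<le> s" "s \<le> t" shows "p i 0 s \<le> p i 0 t"
proof -
  have "(\<Sum>k\<in>{0}. p i k s * p k 0 (t - s)) \<le> p i 0 t"
    using chapman_kolmogorov[of s "t - s" i 0] assms sum_le_suminf[of "\<lambda>k. p i k s * p k 0 (t - s)" "{0}"]
    by (auto simp: sums_iff p_nonneg)
  then show ?thesis using assms by (simp add: p_absorbed)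
qed

text \<open>The limit \<open>g\<close> of the survival probability is harmonic and vanishes at 0,
  hence it is a multiple of \<open>V\<close>. It is bounded and \<open>V\<close> is not, so the
  multiple is 0.\<close>

lemma absorption_certain: "((\<lambda>t. 1 - p i 0 t) \<longlongrightarrow> 0) at_top"
proof -
  have "\<exists>l. ((\<lambda>t. 1 - p k 0 t) \<longlongrightarrow> l) at_top \<and> 0 \<le> l" for k
    using antimono_bounded_below_convergent[of "\<lambda>t. 1 - p k 0 t" 0] p_absorbing_mono p_le_1 by force
  then obtain g where g: "\<And>k. ((\<lambda>t. 1 - p k 0 t) \<longlongrightarrow> g k) at_top" "\<And>k. 0 \<le> g k"
    by metis
  have le1: "g k \<le> 1" for k
    by (rule tendsto_upperbound[OF g(1)]) (auto intro!: eventually_at_top_linorderI[of 0] simp: p_nonneg)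
  have g0: "g 0 = 0"
    by (rule LIMSEQ_unique[of "\<lambda>n. 1 - p 0 0 (real n)"])
      (auto simp: p_absorbed intro!: filterlim_compose[OF g(1)[of 0] filterlim_real_sequentially, simplified])
  have harm: "bd_generator b d g k = 0" for k
  proof -
    have "((\<lambda>t. 1 - p k 0 t) has_real_derivative bd_generator b d (\<lambda>k. 1 - p k 0 t) k) (at t within {0..})"
      if "0 \<le> t" for t
      by (rule derivative_eq_intros backward that refl)+ (simp add: bd_generator_def algebra_simps)
    from derivative_limit_zero[OF this g(1) bd_generator_tendsto[OF g(1)]] show ?thesis .
  qed
  have gV: "g n = g 1 * V n" for n
    by (rule eigenvector_unique[where x = 0]) (simp_all add: harm generator_V g0)
  have "g 1 = 0"
  proof (rule ccontr)
    assume "g 1 \<noteq> 0"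
    then have "0 < g 1" using g(2)[of 1] by simp
    obtain n where "2 / g 1 \<le> V n" using V_at_top by (auto simp: filterlim_at_top eventually_sequentially)
    then have "2 \<le> g n" using \<open>0 < g 1\<close> by (simp add: gV[of n] field_simps)
    with le1[of n] show False by simp
  qed
  then show ?thesis using g(1)[of i] gV[of i] by simp
qed

end

section \<open>Positive recurrence\<close>

text \<open>\<open>a\<close> is \<open>\<xi>\<^sub>1\<close>.\<close>

locale birth_death_positive_recurrent = birth_death_semigroup +
  fixes a :: real
  assumes a_pos: "0 < a" and Q_pos: "1 \<le> n \<Longrightarrow> 0 < Q b d n a"
    and positive_recurrent: "\<exists>i\<ge>1. \<exists>L>0. ((\<lambda>t. exp (a * t) * p i i t) \<longlongrightarrow> L) at_top"
begin

abbreviation q :: "nat \<Rightarrow> real" where "q n \<equiv> Q b d n a"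

definition S :: "nat \<Rightarrow> nat \<Rightarrow> real \<Rightarrow> real" where "S i j t = exp (a * t) * p i j t"

lemma q_nonneg: "0 \<le> q n"
  using Q_pos[of n] by (cases "n = 0") auto

lemma generator_q: "1 \<le> i \<Longrightarrow> bd_generator b d q i = - a * q i"
  using bd_generator_Q[of b i d a] b_pos by simp

lemma S_nonneg: "0 \<le> t \<Longrightarrow> 0 \<le> S i j t"
  by (simp add: S_def p_nonneg)

lemma S_0: "0 \<le> t \<Longrightarrow> 1 \<le> j \<Longrightarrow> S 0 j t = 0"
  by (simp add: S_def p_absorbed)

lemma S_chapman_kolmogorov:
  assumes "0 \<le> s" "0 \<le> t"
  shows "(\<lambda>k. S i k s * S k j t) sums S i j (s + t)"
  using sums_mult[OF chapman_kolmogorov[OF assms, of i j], of "exp (a * s) * exp (a * t)"]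
  by (simp add: S_def exp_add distrib_left mult_ac)

lemma S_derivative:
  assumes "0 \<le> t"
  shows "(S i j has_real_derivative a * S i j t + bd_generator b d (\<lambda>k. S k j t) i) (at t within {0..})"
  unfolding S_def[abs_def] bd_generator_cmult
  by (rule derivative_eq_intros backward assms refl)+ (simp add: algebra_simps)

lemma S_reversible:
  "1 \<le> i \<Longrightarrow> 1 \<le> j \<Longrightarrow> 0 \<le> t \<Longrightarrow> w i * S i j t = w j * S j i t"
  using reversible[of i j t] by (simp add: S_def mult.left_commute)

text \<open>\<open>exp (- (a * s)) * q i\<close> solves the backward equation on the states from 1
  on and starts above the truncated \<open>q\<close>. Truncating the sum at \<open>n\<close>
  supplies the upper bound on \<open>u\<close> that \<open>comparison\<close> asks for, whether or
  not \<open>q\<close> is bounded.\<close>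

lemma q_excessive:
  assumes t: "0 \<le> t"
  shows "(\<Sum>k<n. S i k t * q k) \<le> q i"
proof -
  define u where "u i s = (\<Sum>k<n. q k * p i k s) - exp (- (a * s)) * q i" for i s
  define u' where "u' i s = (\<Sum>k<n. q k * bd_generator b d (\<lambda>i. p i k s) i) + a * exp (- (a * s)) * q i" for i s
  have "u i t \<le> 0"
  proof (rule comparison[where u = u and u' = u' and T = t and B = "\<Sum>k<n. q k"])
    fix i s assume s: "0 \<le> s" "s \<le> t"
    have "(\<Sum>k<n. q k * p i k s) \<le> (\<Sum>k<n. q k)"
      using s by (intro sum_mono mult_left_le) (auto simp: q_nonneg p_le_1)
    moreover have "0 \<le> exp (- (a * s)) * q i" by (simp add: q_nonneg)
    ultimately show "u i s \<le> (\<Sum>k<n. q k)" by (simp add: u_def)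
    have "((\<lambda>s. \<Sum>k<n. q k * p i k s) has_real_derivative (\<Sum>k<n. q k * bd_generator b d (\<lambda>i. p i k s) i)) (at s within {0..t})"
      using s by (intro DERIV_sum DERIV_cmult backward_within) auto
    moreover have "((\<lambda>s. exp (- (a * s)) * q i) has_real_derivative - (a * exp (- (a * s)) * q i)) (at s within {0..t})"
      by (auto intro!: derivative_eq_intros)
    ultimately show "(u i has_real_derivative u' i s) (at s within {0..t})"
      unfolding u_def[abs_def] u'_def using DERIV_diff by fastforce
    assume "0 < u i s"
    moreover have "u 0 s = 0" using s by (auto simp: u_def p_absorbed intro!: sum.neutral)
    ultimately have i: "1 \<le> i" by (cases i) auto
    have "bd_generator b d (\<lambda>i. u i s) i
        = (\<Sum>k<n. q k * bd_generator b d (\<lambda>i. p i k s) i) - exp (- (a * s)) * bd_generator b d q i"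
      unfolding u_def bd_generator_diff bd_generator_sum bd_generator_cmult ..
    then show "1 \<le> i \<and> u' i s \<le> bd_generator b d (\<lambda>k. u k s) i"
      using i by (simp add: u'_def generator_q)
  next
    fix i
    have "(\<Sum>k<n. q k * p i k 0) = (\<Sum>k<n. if k = i then q i else 0)"
      by (intro sum.cong) (auto simp: p_zero)
    also have "\<dots> \<le> q i" by (simp add: q_nonneg)
    finally show "u i 0 \<le> 0" by (simp add: u_def)
  qed (use t in auto)
  then have "exp (a * t) * (\<Sum>k<n. q k * p i k t) \<le> exp (a * t) * (exp (- (a * t)) * q i)"
    by (intro mult_left_mono) (auto simp: u_def)
  then show ?thesis
    by (simp add: S_def sum_distrib_left mult_ac exp_minus field_simps)
qed

lemma S_le:
  assumes "0 \<le> t" "1 \<le> j" shows "S i j t \<le> q i / q j"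
proof -
  have "S i j t * q j \<le> (\<Sum>k<Suc j. S i k t * q k)"
    using assms by (intro member_le_sum) (auto simp: S_nonneg q_nonneg)
  also have "\<dots> \<le> q i" using assms by (intro q_excessive)
  finally show ?thesis using Q_pos[OF assms(2)] by (simp add: field_simps)
qed

text \<open>Symmetry turns Chapman-Kolmogorov for \<open>S i i (s + t)\<close> into a weighted inner
  product of \<open>S k i s\<close> and \<open>S k i t\<close> over \<open>k\<close>; the rest is
  the expansion of a square. Reversibility says nothing at \<open>k = 0\<close>, but that term is
  0.\<close>

lemma S_square_difference:
  assumes i: "1 \<le> i" and s: "0 \<le> s" and t: "0 \<le> t"
  shows "(\<lambda>k. w k / w i * (S k i t - S k i s)\<^sup>2) sums (S i i (2 * t) - 2 * S i i (s + t) + S i i (2 * s))"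
proof -
  have *: "(\<lambda>k. w k / w i * (S k i s * S k i t)) sums S i i (s + t)" if st: "0 \<le> s" "0 \<le> t" for s t
  proof -
    have "S i k s * S k i t = w k / w i * (S k i s * S k i t)" for k
    proof (cases "k = 0")
      case False
      then show ?thesis using S_reversible[of i k s] i st w_pos[of i] by (simp add: field_simps)
    qed (use i st S_0 in simp)
    then show ?thesis using S_chapman_kolmogorov[OF st, of i i] by simp
  qed
  have "(\<lambda>k. w k / w i * (S k i t * S k i t) - 2 * (w k / w i * (S k i s * S k i t)) + w k / w i * (S k i s * S k i s))
      sums (S i i (t + t) - 2 * S i i (s + t) + S i i (s + s))"
    by (intro sums_add sums_diff sums_mult * s t)
  moreover have "w k / w i * (S k i t * S k i t) - 2 * (w k / w i * (S k i s * S k i t)) + w k / w i * (S k i s * S k i s)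
      = w k / w i * (S k i t - S k i s)\<^sup>2" for k
    by (simp add: power2_eq_square algebra_simps)
  ultimately show ?thesis by simp
qed

text \<open>The squared differences make \<open>t \<mapsto> S i i t\<close> midpoint convex, hence monotone and
  convergent, and then they make \<open>S k i\<close> Cauchy.\<close>

lemma S_convergent:
  assumes i: "1 \<le> i"
  obtains l where "(S k i \<longlongrightarrow> l) at_top"
proof -
  have nn: "0 \<le> w n / w i * x\<^sup>2" for n x using w_pos[of n] w_pos[of i] by simp
  have sq: "0 \<le> S i i (2 * t) - 2 * S i i (s + t) + S i i (2 * s)" if "0 \<le> s" "0 \<le> t" for s t
    by (rule sums_le[OF _ sums_zero S_square_difference[OF i that]]) (rule nn)
  have dec: "S i i y \<le> S i i x" if "0 \<le> x" "x \<le> y" for x y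
  proof (rule midpoint_convex_bounded_antimono[OF _ _ that])
    show "S i i t \<le> 1" if "0 \<le> t" for t using S_le[OF that i, of i] Q_pos[OF i] by simp
    show "2 * S i i (s + t) \<le> S i i (2 * s) + S i i (2 * t)" if "0 \<le> s" "0 \<le> t" for s t
      using sq[OF that] by simp
  qed
  obtain l where l: "(S i i \<longlongrightarrow> l) at_top"
    by (rule antimono_bounded_below_convergent[OF dec S_nonneg])
  show thesis
  proof (rule cauchy_at_top_convergent)
    fix e :: real assume e: "0 < e"
    \<comment> \<open>The coefficients 1, -2, 1 of the identity allow a total error below
      \<open>4 * r\<close>. This value of \<open>r\<close> makes that error equal to
      \<open>w k / w i * e\<close> times \<open>e\<close>, so that one term of the sum bounds the
      difference by \<open>e\<close>.\<close>
    define r where "r = e\<^sup>2 * (w k / w i) / 4"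
    have r: "0 < r" using e w_pos[of k] w_pos[of i] by (simp add: r_def)
    from tendstoD[OF l this] obtain T where T: "\<And>t. T \<le> t \<Longrightarrow> \<bar>S i i t - l\<bar> < r"
      by (auto simp: eventually_at_top_linorder dist_real_def)
    have "\<bar>S k i s - S k i t\<bar> < e" if st: "max 0 T \<le> s" "max 0 T \<le> t" for s t
    proof -
      have st0: "0 \<le> s" "0 \<le> t" using st by auto
      have "w k / w i * (S k i t - S k i s)\<^sup>2 \<le> S i i (2 * t) - 2 * S i i (s + t) + S i i (2 * s)"
        using sum_le_suminf[OF sums_summable[OF S_square_difference[OF i st0]], of "{k}"] nn
          sums_unique[OF S_square_difference[OF i st0]] by simp
      also have "\<dots> < 4 * r"
        using T[of "2 * t"] T[of "s + t"] T[of "2 * s"] st by (simp add: abs_less_iff)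
      also have "\<dots> = w k / w i * e\<^sup>2" by (simp add: r_def)
      finally have "(S k i t - S k i s)\<^sup>2 < e\<^sup>2"
        using divide_pos_pos[OF w_pos[of k] w_pos[of i]] by (simp only: mult_less_cancel_left_pos)
      then have "\<not> \<bar>e\<bar> \<le> \<bar>S k i t - S k i s\<bar>" unfolding abs_le_square_iff by simp
      then show ?thesis using e by simp
    qed
    then show "\<exists>T. \<forall>s\<ge>T. \<forall>t\<ge>T. \<bar>S k i s - S k i t\<bar> < e" by blast
  qed (rule that)
qed

definition c :: real where "c = Lim at_top (S 1 1)"

lemma S_tendsto_c:
  assumes "1 \<le> j" shows "(S i j \<longlongrightarrow> c * (q i * (w j * q j))) at_top"
proof -
  define F where "F k j = Lim at_top (S k j)" for k j
  have F: "(S k j \<longlongrightarrow> F k j) at_top" if j: "1 \<le> j" for k j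
  proof -
    obtain l where "(S k j \<longlongrightarrow> l) at_top" using S_convergent[OF j, of k] .
    then show ?thesis using tendsto_Lim[of at_top "S k j" l] by (simp add: F_def)
  qed
  have F0: "F 0 j = 0" if "1 \<le> j" for j
  proof (rule tendsto_unique[OF _ F[OF that]])
    show "(S 0 j \<longlongrightarrow> 0) at_top"
      by (rule tendsto_eventually) (auto intro!: eventually_at_top_linorderI[of 0] S_0 that)
  qed simp
  have gen: "bd_generator b d (\<lambda>k. F k j) k = - a * F k j" if "1 \<le> j" for k j
  proof -
    have "((\<lambda>t. a * S k j t + bd_generator b d (\<lambda>k. S k j t) k)
        \<longlongrightarrow> a * F k j + bd_generator b d (\<lambda>k. F k j) k) at_top"
      by (intro tendsto_intros F bd_generator_tendsto that)
    from derivative_limit_zero[OF S_derivative F[OF that] this] show ?thesis by simp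
  qed
  have Fq: "F k j = F 1 j * q k" if "1 \<le> j" for k j
    using gen[OF that] F0[OF that] by (intro eigenvector_unique[where x = a] generator_q) auto
  have "w 1 * F 1 j = w j * F j 1"
  proof (rule tendsto_unique)
    show "((\<lambda>t. w 1 * S 1 j t) \<longlongrightarrow> w 1 * F 1 j) at_top" by (intro tendsto_intros F assms)
    have "((\<lambda>t. w j * S j 1 t) \<longlongrightarrow> w j * F j 1) at_top" by (intro tendsto_intros F) simp
    then show "((\<lambda>t. w 1 * S 1 j t) \<longlongrightarrow> w j * F j 1) at_top"
      by (rule Lim_transform_eventually)
        (use S_reversible[of 1 j] assms in \<open>auto intro!: eventually_at_top_linorderI[of 0]\<close>)
  qed simp
  moreover have "c = F 1 1" by (simp add: c_def F_def)
  ultimately have "F i j = c * (q i * (w j * q j))"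
    using Fq[OF assms, of i] Fq[of 1 j] by simp
  then show ?thesis using F[OF assms, of i] by simp
qed

lemma c_pos: "0 < c"
proof -
  obtain i L where i: "1 \<le> i" and L: "0 < L" "(S i i \<longlongrightarrow> L) at_top"
    using positive_recurrent unfolding S_def[abs_def] by blast
  have "L = c * (q i * (w i * q i))"
    by (rule tendsto_unique[OF _ L(2) S_tendsto_c[OF i]]) simp
  moreover have "0 < q i * (w i * q i)" using Q_pos[OF i] w_pos[of i] by simp
  ultimately show ?thesis using L(1) by (metis zero_less_mult_pos2)
qed

lemma survival_tendsto: "((\<lambda>t. exp (a * t) * (1 - p i 0 t)) \<longlongrightarrow> d 1 * (c * q i) / a) at_top"
proof (rule exp_tail_tendsto[OF a_pos _ absorption_certain])
  show "((\<lambda>t. 1 - p i 0 t) has_real_derivative - (d 1 * p i 1 s)) (at s within {0..})" if "0 \<le> s" for s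
    using absorption_density[OF that, of i] by (auto intro!: derivative_eq_intros)
  show "((\<lambda>s. exp (a * s) * (d 1 * p i 1 s)) \<longlongrightarrow> d 1 * (c * q i)) at_top"
    using tendsto_mult_left[OF S_tendsto_c[of 1 i], of "d 1"] by (simp add: S_def[abs_def] mult.left_commute)
qed

lemma survival_le:
  assumes "0 \<le> t" shows "exp (a * t) * (1 - p i 0 t) \<le> d 1 * q i / a"
proof (rule exp_tail_upper[OF a_pos _ absorption_certain])
  fix s assume s: "t \<le> s"
  then show "((\<lambda>t. 1 - p i 0 t) has_real_derivative - (d 1 * p i 1 s)) (at s within {t..})"
    using absorption_density[of s i] assms by (auto intro!: derivative_eq_intros intro: DERIV_subset)
  have "d 1 * S i 1 s \<le> d 1 * (q i / q 1)"
    using s assms d_pos[of 1] by (intro mult_left_mono S_le) auto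
  then show "exp (a * s) * (d 1 * p i 1 s) \<le> d 1 * q i" by (simp add: S_def mult.left_commute)
qed

section \<open>Invariance of \<open>q\<close> and the mass of the limit law\<close>

lemma q_invariant:
  assumes s: "0 \<le> s" shows "(\<lambda>k. S i k s * q k) sums q i"
proof -
  have sm: "summable (\<lambda>k. S i k s * q k)"
  proof (rule bounded_imp_summable)
    show "0 \<le> S i k s * q k" for k using s by (simp add: S_nonneg q_nonneg)
    show "(\<Sum>k\<le>n. S i k s * q k) \<le> q i" for n
      using q_excessive[OF s, of i "Suc n"] by (simp only: lessThan_Suc_atMost)
  qed
  \<comment> \<open>\<open>q_excessive\<close> gives only an inequality. Equality comes from letting
    \<open>t\<close> tend to infinity in Chapman-Kolmogorov for \<open>S i 1 (s + t)\<close>: the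
    inequality provides the dominating series, both limits carry the factor \<open>c\<close>, and
    \<open>c\<close> is positive.\<close>
  have "((\<lambda>t. \<Sum>k. S i k s * S k 1 t) \<longlongrightarrow> (\<Sum>k. S i k s * (c * (q k * (w 1 * q 1))))) at_top"
  proof (rule tannery_eventually[OF tendsto_mult_left[OF S_tendsto_c] _ sm])
    show "eventually (\<lambda>t. \<forall>k. \<bar>S i k s * S k 1 t\<bar> \<le> S i k s * q k) at_top"
      using S_le[of _ 1] s
      by (intro eventually_at_top_linorderI[of 0]) (auto simp: abs_mult S_nonneg intro!: mult_left_mono)
  qed auto
  moreover have "((\<lambda>t. \<Sum>k. S i k s * S k 1 t) \<longlongrightarrow> c * q i) at_top"
  proof (rule Lim_transform_eventually)
    have "filterlim (\<lambda>t. s + t) at_top at_top"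
      by (intro filterlim_tendsto_add_at_top[OF tendsto_const] filterlim_ident)
    from filterlim_compose[OF S_tendsto_c[of 1 i] this]
    show "((\<lambda>t. S i 1 (s + t)) \<longlongrightarrow> c * q i) at_top" by simp
    show "eventually (\<lambda>t. S i 1 (s + t) = (\<Sum>k. S i k s * S k 1 t)) at_top"
      using S_chapman_kolmogorov[OF s] by (auto intro!: eventually_at_top_linorderI[of 0] sums_unique)
  qed
  ultimately have "(\<Sum>k. S i k s * (c * q k)) = c * q i"
    using tendsto_unique[of "at_top :: real filter"] by fastforce
  moreover have "(\<Sum>k. S i k s * (c * q k)) = c * (\<Sum>k. S i k s * q k)"
    using suminf_mult[OF sm, of c] by (simp add: mult.left_commute)
  ultimately have "(\<Sum>k. S i k s * q k) = q i" using c_pos by simp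
  then show ?thesis using sm by (simp add: sums_iff)
qed

text \<open>The quotient of the limits of \<open>S i j t\<close> and of
  \<open>exp (a * t) * (1 - p i 0 t)\<close>: the factor \<open>c * q i\<close>, and with it the
  starting state, cancels.\<close>

definition r :: "nat \<Rightarrow> real" where "r j = a / d 1 * (w j * q j)"

lemma r_0 [simp]: "r 0 = 0"
  by (simp add: r_def)

lemma r_nonneg: "0 \<le> r j"
  using a_pos d_pos[of 1] w_pos[of j] q_nonneg[of j] by (simp add: r_def)

text \<open>The partial sums of \<open>S 1 j t\<close> over positive \<open>j\<close> are at most
  the rescaled survival probability. In the limit this bounds the partial sums of \<open>r\<close>
  by 1.\<close>

lemma r_summable: "summable r"
proof (rule bounded_imp_summable[OF r_nonneg])
  fix n
  have "(\<Sum>j=1..n. c * (q 1 * (w j * q j))) \<le> d 1 * (c * q 1) / a"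
  proof (rule tendsto_le[OF _ survival_tendsto tendsto_sum[OF S_tendsto_c]])
    have "(\<Sum>j=1..n. S 1 j t) \<le> exp (a * t) * (1 - p 1 0 t)" if "0 \<le> t" for t
    proof -
      have "(\<Sum>j=0..n. p 1 j t) \<le> 1" using that by (intro sum_p_le_1) auto
      then have "(\<Sum>j=1..n. p 1 j t) \<le> 1 - p 1 0 t" by (subst (asm) sum.atLeast_Suc_atMost) auto
      then show ?thesis by (simp add: S_def sum_distrib_left[symmetric])
    qed
    then show "eventually (\<lambda>t. (\<Sum>j=1..n. S 1 j t) \<le> exp (a * t) * (1 - p 1 0 t)) at_top"
      by (auto intro!: eventually_at_top_linorderI[of 0])
  qed auto
  then have "c * (\<Sum>j=1..n. w j * q j) \<le> c * (d 1 / a)" by (simp add: sum_distrib_left mult_ac)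
  then have "(\<Sum>j=1..n. w j * q j) \<le> d 1 / a" using c_pos by (simp only: mult_le_cancel_left_pos)
  then have "a / d 1 * (\<Sum>j=1..n. w j * q j) \<le> 1" using a_pos d_pos[of 1] by (simp add: field_simps)
  moreover have "(\<Sum>j\<le>n. r j) = a / d 1 * (\<Sum>j=1..n. w j * q j)"
    unfolding atMost_atLeast0 by (subst sum.atLeast_Suc_atMost) (auto simp: r_def sum_distrib_left)
  ultimately show "(\<Sum>j\<le>n. r j) \<le> 1" by simp
qed

text \<open>The dual of \<open>q_invariant\<close>: by symmetry \<open>r i * p i j t\<close> is
  \<open>S j i t * q i\<close> up to a factor that does not depend on \<open>i\<close>.\<close>

lemma r_invariant:
  assumes t: "0 \<le> t" and j: "1 \<le> j"
  shows "(\<lambda>i. r i * p i j t) sums (exp (- (a * t)) * r j)"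
proof -
  have eq: "r i * p i j t = exp (- (a * t)) * (a / d 1 * w j) * (S j i t * q i)" for i
  proof (cases "i = 0")
    case False
    then show ?thesis using reversible[of i j t] assms by (simp add: r_def S_def exp_minus field_simps)
  qed simp
  show ?thesis
    using sums_mult[OF q_invariant[OF t, of j], of "exp (- (a * t)) * (a / d 1 * w j)"]
    unfolding eq by (simp only: r_def mult.assoc)
qed

text \<open>Survival is the sum of \<open>p i j t\<close> over positive \<open>j\<close>. Truncating
  \<open>j\<close> at \<open>n\<close> allows \<open>r_invariant\<close> to be summed finitely
  often, and the limit in \<open>n\<close> is dominated by the summable \<open>r\<close>.\<close>

lemma r_survival:
  assumes t: "0 \<le> t"
  shows "(\<Sum>i. r i * (1 - p i 0 t)) = exp (- (a * t)) * (\<Sum>j. r j)"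
proof -
  have "(\<lambda>n. \<Sum>i. r i * (\<Sum>j=1..n. p i j t)) \<longlonglongrightarrow> (\<Sum>i. r i * (1 - p i 0 t))"
  proof (rule tannery_eventually[OF tendsto_mult_left _ r_summable])
    fix i
    have "(\<lambda>n. \<Sum>j\<le>n. p i j t) \<longlonglongrightarrow> 1" using p_sums_1[OF t] unfolding sums_def_le .
    moreover have "(\<Sum>j\<le>n. p i j t) = p i 0 t + (\<Sum>j=1..n. p i j t)" for n
      unfolding atMost_atLeast0 by (subst sum.atLeast_Suc_atMost) auto
    ultimately have "(\<lambda>n. p i 0 t + (\<Sum>j=1..n. p i j t)) \<longlonglongrightarrow> 1" by simp
    from tendsto_diff[OF this tendsto_const[of "p i 0 t"]]
    show "(\<lambda>n. \<Sum>j=1..n. p i j t) \<longlonglongrightarrow> 1 - p i 0 t" by simp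
  next
    show "eventually (\<lambda>n. \<forall>i. \<bar>r i * (\<Sum>j=1..n. p i j t)\<bar> \<le> r i) sequentially"
      using t by (intro always_eventually allI)
        (auto simp: abs_mult r_nonneg abs_of_nonneg sum_nonneg p_nonneg intro!: mult_left_le sum_p_le_1)
  qed simp
  moreover have "(\<lambda>n. \<Sum>i. r i * (\<Sum>j=1..n. p i j t)) \<longlonglongrightarrow> exp (- (a * t)) * (\<Sum>j. r j)"
  proof -
    have "(\<lambda>i. \<Sum>j=1..n. r i * p i j t) sums (\<Sum>j=1..n. exp (- (a * t)) * r j)" for n
      using t by (intro sums_sum r_invariant) auto
    then have "(\<Sum>i. r i * (\<Sum>j=1..n. p i j t)) = exp (- (a * t)) * (\<Sum>j\<le>n. r j)" for n
      unfolding atMost_atLeast0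
      by (subst sum.atLeast_Suc_atMost) (auto simp: sums_iff sum_distrib_left)
    moreover have "(\<lambda>n. \<Sum>j\<le>n. r j) \<longlonglongrightarrow> (\<Sum>j. r j)"
      using summable_sums[OF r_summable] unfolding sums_def_le .
    ultimately show ?thesis by (simp add: tendsto_mult_left)
  qed
  ultimately show ?thesis by (rule LIMSEQ_unique)
qed

text \<open>Both sides of \<open>\<Sum>\<^sub>i r i * p i 0 h = (1 - exp (- a h)) * \<Sum>\<^sub>j r j\<close> are differentiated at \<open>h = 0\<close>.\<close>

lemma r_sums_1: "r sums 1"
proof -
  define R where "R = (\<Sum>j. r j)"
  \<comment> \<open>The absorption density is at most \<open>d 1\<close> from any state; this
    dominates the difference quotients uniformly in \<open>i\<close>.\<close>
  have le: "p i 0 h \<le> d 1 * h" if "0 \<le> h" "i \<noteq> 0" for i h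
  proof -
    have "norm (p i 0 h - p i 0 0) \<le> d 1 * norm (h - 0)"
      using that d_pos[of 1]
      by (intro field_differentiable_bound[where S = "{0..h}" and f' = "\<lambda>s. d 1 * p i 1 s"])
        (auto intro!: DERIV_subset[OF absorption_density] mult_left_le p_le_1 simp: p_nonneg abs_mult simp del: One_nat_def)
    then show ?thesis using that by (simp add: p_zero p_nonneg)
  qed
  have "((\<lambda>h. \<Sum>i. r i * ((p i 0 h - p i 0 0) / (h - 0))) \<longlongrightarrow> (\<Sum>i. r i * bd_rate b d i 0)) (at 0 within {0..})"
  proof (rule tannery_eventually[OF tendsto_mult_left _ summable_mult2[OF r_summable, of "d 1"]])
    show "((\<lambda>h. (p i 0 h - p i 0 0) / (h - 0)) \<longlongrightarrow> bd_rate b d i 0) (at 0 within {0..})" for i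
      using p_rates[of i 0] by (simp add: has_field_derivative_iff)
    have "\<bar>r i * ((p i 0 h - p i 0 0) / (h - 0))\<bar> \<le> r i * d 1" if "0 < h" for i h
    proof (cases "i = 0")
      case False
      have "r i * (p i 0 h / h) \<le> r i * d 1"
        using le[of h i] that False by (intro mult_left_mono) (auto simp: field_simps r_nonneg)
      then show ?thesis using that False by (simp add: p_zero r_nonneg p_nonneg abs_mult)
    qed simp
    then show "eventually (\<lambda>h. \<forall>i. \<bar>r i * ((p i 0 h - p i 0 0) / (h - 0))\<bar> \<le> r i * d 1) (at 0 within {0..})"
      by (auto simp: eventually_at_filter intro!: always_eventually)
  qed (simp add: at_within_Ici_at_right)
  moreover have "(\<Sum>i. r i * bd_rate b d i 0) = r 1 * d 1"
  proof -
    have "r i * bd_rate b d i 0 = 0" if "i \<noteq> 1" for i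
      using that by (cases "i = 0") (auto simp: bd_rate_def)
    then have "(\<Sum>i. r i * bd_rate b d i 0) = (\<Sum>i\<in>{1}. r i * bd_rate b d i 0)"
      by (intro suminf_finite) auto
    then show ?thesis by (simp add: bd_rate_def)
  qed
  moreover have "((\<lambda>h. \<Sum>i. r i * ((p i 0 h - p i 0 0) / (h - 0))) \<longlongrightarrow> a * R) (at 0 within {0..})"
  proof (rule Lim_transform_eventually)
    have "((\<lambda>h. (1 - exp (- (a * h))) * R) has_real_derivative a * R) (at 0 within {0..})"
      by (auto intro!: derivative_eq_intros)
    then show "((\<lambda>h. (1 - exp (- (a * h))) * R / h) \<longlongrightarrow> a * R) (at 0 within {0..})"
      by (simp add: has_field_derivative_iff)
    have "(1 - exp (- (a * h))) * R / h = (\<Sum>i. r i * ((p i 0 h - p i 0 0) / (h - 0)))" if "0 < h" for h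
    proof -
      have sm: "summable (\<lambda>i. r i * (1 - p i 0 h))"
        using that by (intro summable_comparison_test'[OF r_summable])
          (auto simp: r_nonneg p_nonneg p_le_1 abs_mult intro!: mult_left_le)
      have "(\<Sum>i. r i * p i 0 h) = (\<Sum>i. r i - r i * (1 - p i 0 h))"
        by (simp add: algebra_simps)
      also have "\<dots> = R - exp (- (a * h)) * R"
        unfolding suminf_diff[OF r_summable sm, symmetric] using r_survival[of h] that by (simp add: R_def)
      finally have e: "(\<Sum>i. r i * p i 0 h) = (1 - exp (- (a * h))) * R" by (simp add: algebra_simps)
      have "summable (\<lambda>i. r i * p i 0 h)"
        using that by (intro summable_comparison_test'[OF r_summable])
          (auto simp: r_nonneg p_nonneg p_le_1 abs_mult intro!: mult_left_le)
      from suminf_divide[OF this, of h] e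
      have "(\<Sum>i. r i * p i 0 h / h) = (1 - exp (- (a * h))) * R / h" by simp
      moreover have eq: "r i * ((p i 0 h - p i 0 0) / (h - 0)) = r i * p i 0 h / h" for i
        by (cases "i = 0") (auto simp: p_zero)
      ultimately show ?thesis unfolding eq by simp
    qed
    then show "eventually (\<lambda>h. (1 - exp (- (a * h))) * R / h = (\<Sum>i. r i * ((p i 0 h - p i 0 0) / (h - 0)))) (at 0 within {0..})"
      by (auto simp: eventually_at_filter intro!: always_eventually)
  qed
  \<comment> \<open>State 1 is the only positive state that jumps to 0, so the limit of the
    quotients is \<open>r 1 * d 1\<close>. Computed from the exponential decay of the surviving
    mass, it is \<open>a * R\<close>.\<close>
  ultimately have "a * R = r 1 * d 1"
    by (metis (no_types, lifting) tendsto_unique at_within_Ici_at_right trivial_limit_at_right_real)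
  also have "\<dots> = a" using d_pos[of 1] by (simp add: r_def)
  finally have "R = 1" using a_pos by simp
  then show ?thesis using summable_sums[OF r_summable] by (simp add: R_def)
qed

text \<open>A supersolution \<open>\<phi>\<close> outside a finite set dominates \<open>q\<close>, because it dominates \<open>t \<mapsto> S i n t\<close>
  for all times and the limit of the latter is a multiple of \<open>q i\<close>.\<close>

lemma q_le_lyapunov:
  assumes \<phi>: "\<And>i. 0 \<le> \<phi> i" and n: "1 \<le> n" "0 < \<phi> n"
    and gen: "\<And>i. n < i \<Longrightarrow> bd_generator b d \<phi> i \<le> - a * \<phi> i"
    and i: "n \<le> i"
  shows "q i \<le> \<phi> i / (\<phi> n * (c * (w n * q n)))"
proof -
  have bound: "S i n t \<le> \<phi> i / \<phi> n" if t: "0 \<le> t" for t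
  proof -
    define u where "u i s = (if i < n then 0 else p i n s - exp (- (a * s)) * (\<phi> i / \<phi> n))" for i s
    define u' where "u' i s = (if i < n then 0 else bd_generator b d (\<lambda>i. p i n s) i + a * exp (- (a * s)) * (\<phi> i / \<phi> n))" for i s
    have "u i t \<le> 0"
    proof (rule comparison[where u = u and u' = u' and T = t and B = 1])
      fix j s assume s: "0 \<le> s" "s \<le> t"
      have nn: "0 \<le> exp (- (a * s)) * (\<phi> j / \<phi> n)" using \<phi>[of j] n by simp
      then show "u j s \<le> 1" using p_le_1[OF s(1), of j n] by (simp add: u_def)
      have "((\<lambda>s. p j n s - exp (- (a * s)) * (\<phi> j / \<phi> n)) has_real_derivative
          bd_generator b d (\<lambda>i. p i n s) j + a * exp (- (a * s)) * (\<phi> j / \<phi> n)) (at s within {0..t})"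
        using s n by (auto intro!: derivative_eq_intros backward_within)
      then show "(u j has_real_derivative u' j s) (at s within {0..t})"
        by (cases "j < n") (auto simp: u_def[abs_def] u'_def)
      assume pos: "0 < u j s"
      \<comment> \<open>\<open>S n n\<close> never exceeds 1, so \<open>u\<close> is nonpositive at
        \<open>n\<close>. It can then be positive only beyond \<open>n\<close>, where
        \<open>\<phi>\<close> is a supersolution and both neighbours lie in the second branch of
        \<open>u\<close>.\<close>
      have "u n s = exp (- (a * s)) * (S n n s - 1)"
        using n by (simp add: u_def S_def exp_minus right_diff_distrib)
      also have "\<dots> \<le> 0"
        using S_le[OF s(1) n(1), of n] Q_pos[OF n(1)] by (intro mult_nonneg_nonpos) auto
      finally have j: "n < j" using pos by (cases "j < n"; cases "j = n") (auto simp: u_def)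
      then have "bd_generator b d (\<lambda>k. u k s) j
          = bd_generator b d (\<lambda>k. p k n s - exp (- (a * s)) / \<phi> n * \<phi> k) j"
        by (auto simp: bd_generator_def u_def)
      also have "\<dots> = bd_generator b d (\<lambda>k. p k n s) j - exp (- (a * s)) / \<phi> n * bd_generator b d \<phi> j"
        unfolding bd_generator_diff bd_generator_cmult ..
      also have "\<dots> \<ge> bd_generator b d (\<lambda>k. p k n s) j - exp (- (a * s)) / \<phi> n * (- a * \<phi> j)"
        using gen[OF j] n by (intro diff_left_mono mult_left_mono) auto
      finally show "1 \<le> j \<and> u' j s \<le> bd_generator b d (\<lambda>k. u k s) j"
        using j n by (simp add: u'_def mult_ac)
    next
      fix j show "u j 0 \<le> 0" using \<phi>[of j] n by (auto simp: u_def p_zero)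
    qed (use t in auto)
    then have "exp (a * t) * p i n t \<le> exp (a * t) * (exp (- (a * t)) * (\<phi> i / \<phi> n))"
      using i by (intro mult_left_mono) (auto simp: u_def)
    then show ?thesis by (simp add: S_def exp_minus field_simps)
  qed
  have "c * (q i * (w n * q n)) \<le> \<phi> i / \<phi> n"
    by (rule tendsto_upperbound[OF S_tendsto_c[OF n(1), of i]])
      (auto intro!: eventually_at_top_linorderI[of 0] bound)
  moreover have "0 < c * (w n * q n)" using c_pos w_pos[of n] Q_pos[OF n(1)] by simp
  ultimately show ?thesis using n by (simp add: field_simps)
qed

section \<open>Mixed initial laws\<close>

lemma mixture_tendsto:
  assumes \<mu>: "\<And>i. 0 \<le> \<mu> i" "summable (\<lambda>i. \<mu> i * q i)"
  shows "1 \<le> j \<Longrightarrow> ((\<lambda>t. exp (a * t) * (\<Sum>i. \<mu> i * p i j t))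
      \<longlongrightarrow> (c * w j * q j) * (\<Sum>i. \<mu> i * q i)) at_top"
    and "((\<lambda>t. exp (a * t) * (\<Sum>i. \<mu> i * (1 - p i 0 t))) \<longlongrightarrow> (d 1 * c / a) * (\<Sum>i. \<mu> i * q i)) at_top"
proof -
  \<comment> \<open>Dominated convergence in a form that serves both limits: \<open>f\<close> is
    \<open>p i j\<close> with \<open>K = 1 / q j\<close>, or the survival probability with
    \<open>K = d 1 / a\<close>.\<close>
  have *: "((\<lambda>t. exp (a * t) * (\<Sum>i. \<mu> i * f i t)) \<longlongrightarrow> C * (\<Sum>i. \<mu> i * q i)) at_top"
    if lim: "\<And>i. ((\<lambda>t. exp (a * t) * f i t) \<longlongrightarrow> C * q i) at_top"
      and bnd: "\<And>i t. 0 \<le> t \<Longrightarrow> 0 \<le> f i t \<and> exp (a * t) * f i t \<le> K * q i" for f C K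
  proof (rule Lim_transform_eventually)
    show "((\<lambda>t. \<Sum>i. \<mu> i * (exp (a * t) * f i t)) \<longlongrightarrow> C * (\<Sum>i. \<mu> i * q i)) at_top"
      unfolding suminf_mult[OF \<mu>(2), symmetric] mult.left_commute[of C]
    proof (rule tannery_eventually[OF tendsto_mult_left[OF lim] _ summable_mult[OF \<mu>(2), of K]])
      show "eventually (\<lambda>t. \<forall>i. \<bar>\<mu> i * (exp (a * t) * f i t)\<bar> \<le> K * (\<mu> i * q i)) at_top"
        using bnd \<mu>(1) by (intro eventually_at_top_linorderI[of 0])
          (auto simp: abs_mult mult.left_commute[of K] intro!: mult_left_mono)
    qed simp
    have "(\<Sum>i. \<mu> i * (exp (a * t) * f i t)) = exp (a * t) * (\<Sum>i. \<mu> i * f i t)" if "0 \<le> t" for t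
    proof -
      have "summable (\<lambda>i. \<mu> i * (exp (a * t) * f i t))"
        using bnd[OF that] \<mu>(1)
        by (intro summable_comparison_test'[OF summable_mult[OF \<mu>(2), of K]])
          (auto simp: abs_mult mult.left_commute[of K] intro!: mult_left_mono)
      moreover have eq: "exp (- (a * t)) * (\<mu> i * (exp (a * t) * f i t)) = \<mu> i * f i t" for i
        by (simp add: exp_minus)
      ultimately have "(\<Sum>i. \<mu> i * f i t) = exp (- (a * t)) * (\<Sum>i. \<mu> i * (exp (a * t) * f i t))"
        using suminf_mult[of "\<lambda>i. \<mu> i * (exp (a * t) * f i t)" "exp (- (a * t))"] by (simp only: eq)
      then show ?thesis by (simp add: exp_minus)
    qed
    then show "eventually (\<lambda>t. (\<Sum>i. \<mu> i * (exp (a * t) * f i t)) = exp (a * t) * (\<Sum>i. \<mu> i * f i t)) at_top"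
      by (intro eventually_at_top_linorderI[of 0])
  qed
  show "((\<lambda>t. exp (a * t) * (\<Sum>i. \<mu> i * p i j t)) \<longlongrightarrow> (c * w j * q j) * (\<Sum>i. \<mu> i * q i)) at_top" if "1 \<le> j"
    using S_tendsto_c[OF that] S_le[OF _ that]
    by (intro *[where K = "1 / q j"]) (auto simp: S_def[abs_def] mult_ac p_nonneg)
  show "((\<lambda>t. exp (a * t) * (\<Sum>i. \<mu> i * (1 - p i 0 t))) \<longlongrightarrow> (d 1 * c / a) * (\<Sum>i. \<mu> i * q i)) at_top"
    using survival_tendsto survival_le p_le_1
    by (intro *[where K = "d 1 / a"]) (auto simp: mult_ac)
qed

text \<open>The exponential factor and the integral of \<open>q\<close> cancel in the quotient. The
  integral is positive because some state from 1 on is charged.\<close>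

lemma conditional_tendsto:
  assumes \<mu>: "\<And>i. 0 \<le> \<mu> i" "summable (\<lambda>i. \<mu> i * q i)" "0 < \<mu> k" "1 \<le> k" and j: "1 \<le> j"
  shows "((\<lambda>t. (\<Sum>i. \<mu> i * p i j t) / (\<Sum>i. \<mu> i * (1 - p i 0 t))) \<longlongrightarrow> r j) at_top"
proof -
  define M where "M = (\<Sum>i. \<mu> i * q i)"
  have M: "0 < M" unfolding M_def
    by (rule suminf_pos2[of _ k]) (use \<mu> Q_pos q_nonneg in auto)
  have "((\<lambda>t. (exp (a * t) * (\<Sum>i. \<mu> i * p i j t)) / (exp (a * t) * (\<Sum>i. \<mu> i * (1 - p i 0 t))))
      \<longlongrightarrow> ((c * w j * q j) * M) / ((d 1 * c / a) * M)) at_top"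
    unfolding M_def using M c_pos d_pos[of 1] a_pos
    by (intro tendsto_divide mixture_tendsto \<mu> j) (auto simp: M_def)
  moreover have "((c * w j * q j) * M) / ((d 1 * c / a) * M) = r j"
    using M c_pos d_pos[of 1] a_pos by (simp add: r_def)
  ultimately show ?thesis by simp
qed

end

section \<open>The process and its conditional laws\<close>

lemma partition_sums:
  fixes f :: "'a \<Rightarrow> nat"
  assumes "finite_measure M" "f \<in> M \<rightarrow>\<^sub>M count_space UNIV" "{\<omega> \<in> space M. R \<omega>} \<in> sets M"
  shows "(\<lambda>j. measure M {\<omega> \<in> space M. f \<omega> = j \<and> R \<omega>}) sums measure M {\<omega> \<in> space M. R \<omega>}"
proof -
  interpret finite_measure M by fact
  have "(f -` {j} \<inter> space M) \<inter> {\<omega> \<in> space M. R \<omega>} \<in> sets M" for j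
    using assms(2,3) by (intro sets.Int measurable_sets[OF assms(2)]) auto
  also have "(f -` {j} \<inter> space M) \<inter> {\<omega> \<in> space M. R \<omega>} = {\<omega> \<in> space M. f \<omega> = j \<and> R \<omega>}" for j by auto
  finally have "(\<lambda>j. measure M {\<omega> \<in> space M. f \<omega> = j \<and> R \<omega>})
      sums measure M (\<Union>j. {\<omega> \<in> space M. f \<omega> = j \<and> R \<omega>})"
    by (intro finite_measure_UNION) (auto simp: disjoint_family_on_def)
  moreover have "(\<Union>j. {\<omega> \<in> space M. f \<omega> = j \<and> R \<omega>}) = {\<omega> \<in> space M. R \<omega>}" by auto
  ultimately show ?thesis by simp
qed

lemma embed_pmf_nat:
  fixes f :: "nat \<Rightarrow> real"
  assumes "\<And>i. 0 \<le> f i" "f sums 1"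
  shows "pmf (embed_pmf f) i = f i"
  using suminf_ennreal_eq[OF assms] assms(1) by (intro pmf_embed_pmf) (auto simp: nn_integral_count_space_nat)

lemma M1_pmf_0: "\<mu> \<in> M1 \<Longrightarrow> pmf \<mu> 0 = 0"
  by (auto simp: M1_def pmf_eq_0_set_pmf)

lemma M1_charges_positive:
  assumes "\<mu> \<in> M1" obtains k where "1 \<le> k" "0 < pmf \<mu> k"
proof -
  obtain k where "k \<in> set_pmf \<mu>" using set_pmf_not_empty[of \<mu>] by blast
  with assms that[of k] show thesis by (auto simp: M1_def pmf_positive)
qed

text \<open>The sums in the theorem run over positive states. The term at 0 can be added because
  \<open>\<mu>\<close> does not charge 0, whatever the value \<open>f 0\<close>.\<close>

lemma summable_M1_weighted:
  assumes "\<mu> \<in> M1" "(\<lambda>i. pmf \<mu> i * f i) summable_on {1..}"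
  shows "summable (\<lambda>i. pmf \<mu> i * f i)"
proof -
  have "(\<lambda>i. pmf \<mu> i * f i) summable_on UNIV"
    using assms(2) by (rule summable_on_cong_neutral[THEN iffD1, rotated 3])
      (auto simp: M1_pmf_0[OF assms(1)] not_less_eq_eq)
  then show ?thesis by (rule summable_on_imp_summable)
qed

context birth_death_process
begin

lemma X_in_sets: "0 \<le> t \<Longrightarrow> {\<omega> \<in> space (P i). X t \<omega> \<in> A} \<in> sets (P i)"
  using measurable_sets[OF measurable_X, of t A i] by (simp add: vimage_def Int_def conj_commute)

lemma X_eq_in_sets: "0 \<le> t \<Longrightarrow> {\<omega> \<in> space (P i). X t \<omega> = j} \<in> sets (P i)"
  using X_in_sets[of t i "{j}"] by simp

lemma space_P: "space (P i) = space (P 0)"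
  using sets_P by (rule sets_eq_imp_space_eq)

lemma finite_measure_P: "finite_measure (P i)"
  using prob_space_P by (rule prob_space.finite_measure)

definition transition :: "nat \<Rightarrow> nat \<Rightarrow> real \<Rightarrow> real" where
  "transition i j t = \<P>(\<omega> in P i. X t \<omega> = j)"

lemma transition_zero: "transition i j 0 = (if i = j then 1 else 0)"
proof (cases "i = j")
  case True
  then show ?thesis using start by (simp add: transition_def)
next
  case False
  interpret prob_space "P i" by (rule prob_space_P)
  have "AE \<omega> in P i. X 0 \<omega> = i"
    using start[of i] X_eq_in_sets[of 0 i i] by (subst prob_Collect_eq_1[symmetric]) auto
  then have "AE \<omega> in P i. \<not> X 0 \<omega> = j" by eventually_elim (use False in auto)
  then show ?thesis using False by (simp add: transition_def prob_eq_0_AE)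
qed

lemma markov_simple:
  "0 \<le> s \<Longrightarrow> 0 \<le> t \<Longrightarrow> \<P>(\<omega> in P i. X s \<omega> = k \<and> X (s + t) \<omega> = j) = transition i k s * transition k j t"
  using markov[of s t "space (P i)" i k j] sigma_sets_top[of "space (P i)"]
  by (simp add: transition_def cong: conj_cong)

lemma transition_semigroup:
  assumes "b 0 = 0" "d 0 = 0" "\<And>i. 1 \<le> i \<Longrightarrow> 0 < b i" "\<And>i. 1 \<le> i \<Longrightarrow> 0 < d i"
    and "filterlim (\<lambda>N. \<Sum>n=1..N. (\<Prod>k=1..n. d k) / (\<Prod>k=1..n. b k)) at_top sequentially"
  shows "birth_death_semigroup b d transition"
proof
  fix i j :: nat and s t :: real
  show "0 \<le> transition i j t" by (simp add: transition_def)
  show "(\<lambda>j. transition i j t) sums 1" if "0 \<le> t"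
    using partition_sums[OF finite_measure_P measurable_X[OF that], of i "\<lambda>_. True"]
      prob_space.prob_space[OF prob_space_P, of i]
    by (simp add: transition_def)
  show "(\<lambda>k. transition i k s * transition k j t) sums transition i j (s + t)" if "0 \<le> s" "0 \<le> t"
    using partition_sums[OF finite_measure_P measurable_X[OF that(1)], of i "\<lambda>\<omega>. X (s + t) \<omega> = j"]
      X_eq_in_sets[of "s + t" i j] that
    by (simp add: markov_simple transition_def[of i j "s + t"])
  show "transition i j 0 = (if i = j then 1 else 0)" by (rule transition_zero)
  show "((\<lambda>h. transition i j h) has_real_derivative bd_rate b d i j) (at 0 within {0..})"
    using rates by (simp add: transition_def)
qed (use assms in auto)

text \<open>Right continuity makes a visit to \<open>0\<close> visible at a rational time.\<close>

lemma survival_iff: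
  assumes "\<omega> \<in> space (P i)" "0 \<le> t"
  shows "ereal t < absorption_time X \<omega> \<longleftrightarrow> X t \<omega> \<noteq> 0 \<and> (\<forall>q\<in>\<rat> \<inter> {0..<t}. X q \<omega> \<noteq> 0)"
proof -
  have const: "\<exists>e>0. \<forall>r. s \<le> r \<and> r < s + e \<longrightarrow> X r \<omega> = X s \<omega>" if "0 \<le> s" for s
  proof -
    have "eventually (\<lambda>r. X r \<omega> = X s \<omega>) (at_right s)"
      using right_continuous[OF that assms(1)] by (simp add: tendsto_discrete)
    then obtain u where u: "s < u" "\<And>r. s < r \<Longrightarrow> r < u \<Longrightarrow> X r \<omega> = X s \<omega>"
      by (auto simp: eventually_at_right_field)
    show ?thesis
    proof (intro exI conjI allI impI)
      show "0 < u - s" using u(1) by simp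
      show "X r \<omega> = X s \<omega>" if "s \<le> r \<and> r < s + (u - s)" for r
        using u(2)[of r] that by (cases "r = s") auto
    qed
  qed
  let ?A = "{ereal s | s. 0 \<le> s \<and> X s \<omega> = 0}"
  show ?thesis
  proof
    assume surv: "ereal t < absorption_time X \<omega>"
    have nz: "X s \<omega> \<noteq> 0" if s: "0 \<le> s" "s \<le> t" for s
    proof
      assume "X s \<omega> = 0"
      with s have "ereal s \<in> ?A" by (intro CollectI exI[of _ s] conjI refl)
      then have "absorption_time X \<omega> \<le> ereal s" unfolding absorption_time_def by (rule Inf_lower)
      also have "ereal s \<le> ereal t" unfolding ereal_less_eq(3) by (rule s(2))
      finally have "absorption_time X \<omega> \<le> ereal t" .
      from leD[OF this] surv show False by (rule notE)
    qed
    show "X t \<omega> \<noteq> 0 \<and> (\<forall>q\<in>\<rat> \<inter> {0..<t}. X q \<omega> \<noteq> 0)"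
    proof (intro conjI ballI)
      show "X q \<omega> \<noteq> 0" if "q \<in> \<rat> \<inter> {0..<t}" for q by (rule nz) (use that in auto)
    qed (rule nz[OF assms(2) order.refl])
  next
    assume R: "X t \<omega> \<noteq> 0 \<and> (\<forall>q\<in>\<rat> \<inter> {0..<t}. X q \<omega> \<noteq> 0)"
    have nz: "X s \<omega> \<noteq> 0" if s: "0 \<le> s" "s < t" for s
    proof -
      obtain e where e: "0 < e" "\<forall>r. s \<le> r \<and> r < s + e \<longrightarrow> X r \<omega> = X s \<omega>" using const[OF s(1)] by blast
      have "s < min t (s + e)" using s e(1) by simp
      from Rats_dense_in_real[OF this]
      obtain q where q: "q \<in> \<rat>" "s < q" "q < min t (s + e)" by blast
      then have "s \<le> q \<and> q < s + e" "q \<in> \<rat> \<inter> {0..<t}" using s by auto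
      then have "X q \<omega> = X s \<omega>" "X q \<omega> \<noteq> 0" using e(2) R by blast+
      then show ?thesis by simp
    qed
    \<comment> \<open>The path keeps its nonzero value for a while after \<open>t\<close>. Without
      this the infimum could equal \<open>t\<close> and the strict inequality would fail.\<close>
    obtain e where e: "0 < e" "\<forall>r. t \<le> r \<and> r < t + e \<longrightarrow> X r \<omega> = X t \<omega>" using const[OF assms(2)] by blast
    have "t + e \<le> s" if s: "0 \<le> s" "X s \<omega> = 0" for s
    proof (rule ccontr)
      assume "\<not> t + e \<le> s"
      moreover have "t \<le> s" using nz[OF s(1)] s(2) by (cases "s < t") auto
      ultimately have "X s \<omega> = X t \<omega>" using e(2) not_le by blast
      with R s(2) show False by simp
    qed
    then have "ereal (t + e) \<le> absorption_time X \<omega>"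
      unfolding absorption_time_def by (intro Inf_greatest) auto
    moreover have "ereal t < ereal (t + e)" using e by simp
    ultimately show "ereal t < absorption_time X \<omega>" by (rule less_le_trans[rotated])
  qed
qed

lemma survival_in_sets:
  assumes "0 \<le> t"
  shows "{\<omega> \<in> space (P i). ereal t < absorption_time X \<omega>} \<in> sets (P i)"
proof -
  have "{\<omega> \<in> space (P i). ereal t < absorption_time X \<omega>}
      = {\<omega> \<in> space (P i). X t \<omega> \<in> - {0}} - (\<Union>q\<in>\<rat> \<inter> {0..<t}. {\<omega> \<in> space (P i). X q \<omega> = 0})"
    (is "?L = ?R")
  proof (rule set_eqI)
    show "\<omega> \<in> ?L \<longleftrightarrow> \<omega> \<in> ?R" for \<omega>
      by (cases "\<omega> \<in> space (P i)") (auto simp: survival_iff[OF _ assms])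
  qed
  also have "\<dots> \<in> sets (P i)"
    by (intro sets.Diff X_in_sets assms sets.countable_UN'' countable_Int1 countable_rat X_eq_in_sets) auto
  finally show ?thesis .
qed

lemma sets_law: "sets (law P \<mu>) = sets (P 0)"
  unfolding law_def by (rule sets_bind) (rule sets_P, simp)

lemma space_law: "space (law P \<mu>) = space (P 0)"
  using sets_law by (rule sets_eq_imp_space_eq)

lemma law_sums:
  assumes "A \<in> sets (P 0)"
  shows "(\<lambda>i. pmf \<mu> i * measure (P i) A) sums measure (law P \<mu>) A"
proof -
  have m: "emeasure (P i) A = ennreal (measure (P i) A)" for i
    using finite_measure.emeasure_eq_measure[OF finite_measure_P] .
  have "summable (\<lambda>i. pmf \<mu> i)"
    using partition_sums[of "measure_pmf \<mu>" "\<lambda>i. i" "\<lambda>_. True"]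
    by (simp add: measure_pmf.finite_measure_axioms sums_iff pmf.rep_eq)
  then have sm: "summable (\<lambda>i. pmf \<mu> i * measure (P i) A)"
    by (rule summable_comparison_test'[where N = 0])
      (auto simp: abs_mult intro!: mult_left_le prob_space.prob_le_1 prob_space_P)
  have "emeasure (law P \<mu>) A = (\<Sum>i. ennreal (pmf \<mu> i * measure (P i) A))"
    by (simp add: emeasure_law[OF assms] nn_integral_measure_pmf nn_integral_count_space_nat m ennreal_mult)
  also have "\<dots> = ennreal (\<Sum>i. pmf \<mu> i * measure (P i) A)"
    by (rule suminf_ennreal2[OF _ sm]) simp
  finally have "measure (law P \<mu>) A = (\<Sum>i. pmf \<mu> i * measure (P i) A)"
    by (simp add: measure_def[of "law P \<mu>"] suminf_nonneg[OF sm])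
  then show ?thesis using sm by (simp add: sums_iff)
qed

lemma finite_measure_law: "finite_measure (law P \<mu>)"
proof
  have "emeasure (P i) (space (P 0)) = 1" for i
    using prob_space.emeasure_space_1[OF prob_space_P, of i] space_P[of i] by simp
  then show "emeasure (law P \<mu>) (space (law P \<mu>)) \<noteq> \<infinity>"
    by (simp add: space_law emeasure_law)
qed

end

section \<open>Survival events and conditional laws\<close>

locale absorbed_birth_death_process = birth_death_process +
  assumes semigroup: "birth_death_semigroup b d transition"
begin

text \<open>Individual paths may leave 0. A path that does so and is at \<open>j\<close> at time
  \<open>t\<close> is seen at 0 at some rational time \<open>q\<close> before \<open>t\<close>; the
  Markov property at \<open>q\<close> gives this event the factor
  \<open>transition 0 j (t - q) = 0\<close>, and there are countably many pairs of \<open>q\<close>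
  and \<open>j\<close>.\<close>

lemma AE_survival:
  assumes t: "0 \<le> t"
  shows "AE \<omega> in P i. ereal t < absorption_time X \<omega> \<longleftrightarrow> X t \<omega> \<noteq> 0"
proof -
  interpret prob_space "P i" by (rule prob_space_P)
  have "AE \<omega> in P i. \<forall>q\<in>\<rat> \<inter> {0..<t}. \<forall>j\<in>{1..}. \<not> (X q \<omega> = 0 \<and> X t \<omega> = j)"
  proof (intro AE_ball_countable[THEN iffD2] ballI countable_Int1 countable_rat)
    fix q j assume q: "q \<in> \<rat> \<inter> {0..<t}" and j: "j \<in> {1::nat..}"
    have "{\<omega> \<in> space (P i). X q \<omega> = 0} \<inter> {\<omega> \<in> space (P i). X t \<omega> = j} \<in> sets (P i)"
      using q t by (intro sets.Int X_eq_in_sets) auto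
    also have "{\<omega> \<in> space (P i). X q \<omega> = 0} \<inter> {\<omega> \<in> space (P i). X t \<omega> = j}
        = {\<omega> \<in> space (P i). X q \<omega> = 0 \<and> X t \<omega> = j}" by auto
    finally have m: "{\<omega> \<in> space (P i). X q \<omega> = 0 \<and> X t \<omega> = j} \<in> sets (P i)" .
    have "\<P>(\<omega> in P i. X q \<omega> = 0 \<and> X t \<omega> = j) = transition i 0 q * transition 0 j (t - q)"
      using markov_simple[of q "t - q" i 0 j] q by simp
    also have "transition 0 j (t - q) = 0"
      using birth_death_semigroup.p_absorbed[OF semigroup, of "t - q" j] q j by simp
    finally show "AE \<omega> in P i. \<not> (X q \<omega> = 0 \<and> X t \<omega> = j)"
      using prob_Collect_eq_0[OF m] by simp
  qed auto
  then show ?thesis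
  proof (rule AE_mp[OF _ AE_I2[OF impI]])
    fix \<omega> assume \<omega>: "\<omega> \<in> space (P i)" and A: "\<forall>q\<in>\<rat> \<inter> {0..<t}. \<forall>j\<in>{1..}. \<not> (X q \<omega> = 0 \<and> X t \<omega> = j)"
    then have "X t \<omega> \<noteq> 0 \<Longrightarrow> \<forall>q\<in>\<rat> \<inter> {0..<t}. X q \<omega> \<noteq> 0" by auto
    with survival_iff[OF \<omega> t] show "ereal t < absorption_time X \<omega> \<longleftrightarrow> X t \<omega> \<noteq> 0" by blast
  qed
qed

lemma measure_surviving:
  assumes t: "0 \<le> t"
  shows "measure (P i) {\<omega> \<in> space (P i). X t \<omega> \<in> A \<and> ereal t < absorption_time X \<omega>}
    = measure (P i) {\<omega> \<in> space (P i). X t \<omega> \<in> A - {0}}"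
proof (rule finite_measure.finite_measure_eq_AE[OF finite_measure_P])
  show "AE \<omega> in P i. \<omega> \<in> {\<omega> \<in> space (P i). X t \<omega> \<in> A \<and> ereal t < absorption_time X \<omega>}
      \<longleftrightarrow> \<omega> \<in> {\<omega> \<in> space (P i). X t \<omega> \<in> A - {0}}"
    using AE_survival[OF t, of i] by eventually_elim auto
  have "{\<omega> \<in> space (P i). X t \<omega> \<in> A} \<inter> {\<omega> \<in> space (P i). ereal t < absorption_time X \<omega>} \<in> sets (P i)"
    using t by (intro sets.Int X_in_sets survival_in_sets)
  also have "{\<omega> \<in> space (P i). X t \<omega> \<in> A} \<inter> {\<omega> \<in> space (P i). ereal t < absorption_time X \<omega>}
      = {\<omega> \<in> space (P i). X t \<omega> \<in> A \<and> ereal t < absorption_time X \<omega>}" by auto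
  finally show "{\<omega> \<in> space (P i). X t \<omega> \<in> A \<and> ereal t < absorption_time X \<omega>} \<in> sets (P i)" .
qed (rule X_in_sets[OF t])

lemma conditional_law_eq:
  assumes t: "0 \<le> t"
  shows "conditional_law P X \<mu> t A
    = measure (law P \<mu>) {\<omega> \<in> space (P 0). X t \<omega> \<in> A - {0}} / (\<Sum>i. pmf \<mu> i * (1 - transition i 0 t))"
proof -
  have law_eq: "measure (law P \<mu>) {\<omega> \<in> space (P 0). X t \<omega> \<in> B \<and> ereal t < absorption_time X \<omega>}
      = measure (law P \<mu>) {\<omega> \<in> space (P 0). X t \<omega> \<in> B - {0}}" for B
  proof -
    have "{\<omega> \<in> space (P 0). X t \<omega> \<in> B} \<inter> {\<omega> \<in> space (P 0). ereal t < absorption_time X \<omega>} \<in> sets (P 0)"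
      using t by (intro sets.Int X_in_sets survival_in_sets)
    also have "{\<omega> \<in> space (P 0). X t \<omega> \<in> B} \<inter> {\<omega> \<in> space (P 0). ereal t < absorption_time X \<omega>}
        = {\<omega> \<in> space (P 0). X t \<omega> \<in> B \<and> ereal t < absorption_time X \<omega>}" by auto
    finally have "(\<lambda>i. pmf \<mu> i * measure (P i) {\<omega> \<in> space (P 0). X t \<omega> \<in> B \<and> ereal t < absorption_time X \<omega>})
        sums measure (law P \<mu>) {\<omega> \<in> space (P 0). X t \<omega> \<in> B \<and> ereal t < absorption_time X \<omega>}"
      by (rule law_sums)
    moreover have "measure (P i) {\<omega> \<in> space (P 0). X t \<omega> \<in> B \<and> ereal t < absorption_time X \<omega>}
        = measure (P i) {\<omega> \<in> space (P 0). X t \<omega> \<in> B - {0}}" for i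
      using measure_surviving[OF t, of i B] unfolding space_P[of i] .
    ultimately show ?thesis
      using law_sums[OF X_in_sets[OF t], of \<mu> "B - {0}"] sums_unique2 by simp
  qed
  have "measure (law P \<mu>) {\<omega> \<in> space (P 0). X t \<omega> \<in> UNIV - {0}} = (\<Sum>i. pmf \<mu> i * (1 - transition i 0 t))"
  proof -
    have "measure (P i) {\<omega> \<in> space (P 0). X t \<omega> \<in> UNIV - {0}} = 1 - transition i 0 t" for i
      using prob_space.prob_neg[OF prob_space_P, of i "\<lambda>\<omega>. X t \<omega> = 0"] X_eq_in_sets[OF t, of i 0]
      by (simp add: transition_def space_P[of i])
    then show ?thesis using law_sums[OF X_in_sets[OF t], of \<mu> "UNIV - {0}"] by (simp add: sums_iff)
  qed
  with law_eq[of UNIV] have "measure (law P \<mu>) {\<omega> \<in> space (P 0). ereal t < absorption_time X \<omega>}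
      = (\<Sum>i. pmf \<mu> i * (1 - transition i 0 t))" by simp
  then show ?thesis using law_eq[of A]
    by (simp add: conditional_law_def cond_prob_def space_law)
qed

lemma law_X_eq:
  assumes t: "0 \<le> t"
  shows "measure (law P \<mu>) {\<omega> \<in> space (P 0). X t \<omega> = j} = (\<Sum>i. pmf \<mu> i * transition i j t)"
proof -
  have "measure (P i) {\<omega> \<in> space (P 0). X t \<omega> = j} = transition i j t" for i
    by (simp add: transition_def space_P[of i])
  then show ?thesis using law_sums[OF X_eq_in_sets[OF t], of \<mu> j] by (simp add: sums_iff)
qed

end

section \<open>The limit law as minimal quasi-stationary distribution\<close>

locale positive_recurrent_process = absorbed_birth_death_process +
  fixes a :: real
  assumes positive_recurrent_semigroup: "birth_death_positive_recurrent b d transition a"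
begin

sublocale birth_death_positive_recurrent b d transition a
  by (rule positive_recurrent_semigroup)

lemma attracted:
  assumes \<mu>: "\<mu> \<in> M1" "summable (\<lambda>i. pmf \<mu> i * q i)" and j: "1 \<le> j"
  shows "((\<lambda>t. conditional_law P X \<mu> t {j}) \<longlongrightarrow> r j) at_top"
proof -
  obtain k where k: "1 \<le> k" "0 < pmf \<mu> k" using M1_charges_positive[OF \<mu>(1)] .
  show ?thesis
  proof (rule Lim_transform_eventually)
    show "((\<lambda>t. (\<Sum>i. pmf \<mu> i * transition i j t) / (\<Sum>i. pmf \<mu> i * (1 - transition i 0 t))) \<longlongrightarrow> r j) at_top"
      by (rule conditional_tendsto[OF _ \<mu>(2) k(2,1) j]) simp
    have "{j} - {0} = {j}" using j by auto
    then show "eventually (\<lambda>t. (\<Sum>i. pmf \<mu> i * transition i j t) / (\<Sum>i. pmf \<mu> i * (1 - transition i 0 t))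
        = conditional_law P X \<mu> t {j}) at_top"
      by (intro eventually_at_top_linorderI[of 0]) (simp add: conditional_law_eq law_X_eq)
  qed
qed

definition \<rho> :: "nat pmf" where "\<rho> = embed_pmf r"

lemma pmf_\<rho>: "pmf \<rho> j = r j"
  unfolding \<rho>_def using r_nonneg r_sums_1 by (rule embed_pmf_nat)

lemma \<rho>_in_M1: "\<rho> \<in> M1"
proof -
  have "1 \<le> j" if "r j \<noteq> 0" for j using that by (cases j) auto
  then show ?thesis by (auto simp: M1_def set_pmf_iff pmf_\<rho>)
qed

lemma quasi_stationary_\<rho>: "quasi_stationary P X \<rho>"
  unfolding quasi_stationary_def
proof (intro conjI \<rho>_in_M1 allI impI)
  fix t :: real and A :: "nat set"
  assume t: "0 \<le> t"
  let ?M = "law P \<rho>"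
  have "{\<omega> \<in> space ?M. X t \<omega> \<in> A - {0}} \<in> sets ?M"
    using X_in_sets[OF t, of 0] by (simp only: sets_law space_law)
  moreover have "X t \<in> ?M \<rightarrow>\<^sub>M count_space UNIV"
    using measurable_X[OF t, of 0] sets_law[of \<rho>] by (simp cong: measurable_cong_sets)
  ultimately have "(\<lambda>j. measure ?M {\<omega> \<in> space ?M. X t \<omega> = j \<and> X t \<omega> \<in> A - {0}})
      sums measure ?M {\<omega> \<in> space ?M. X t \<omega> \<in> A - {0}}"
    by (intro partition_sums finite_measure_law)
  moreover have "measure ?M {\<omega> \<in> space ?M. X t \<omega> = j \<and> X t \<omega> \<in> A - {0}}
      = exp (- (a * t)) * measure_pmf.prob \<rho> {i. i = j \<and> i \<in> A}" for j
  proof (cases "j \<in> A - {0}")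
    case True
    then have e: "{\<omega> \<in> space ?M. X t \<omega> = j \<and> X t \<omega> \<in> A - {0}} = {\<omega> \<in> space (P 0). X t \<omega> = j}"
      "{i. i = j \<and> i \<in> A} = {j}" by (auto simp: space_law)
    have "(\<Sum>i. pmf \<rho> i * transition i j t) = exp (- (a * t)) * r j"
      using r_invariant[OF t, of j] True by (simp add: pmf_\<rho> sums_iff)
    then show ?thesis unfolding e law_X_eq[OF t] by (simp add: pmf_\<rho>[symmetric] pmf.rep_eq)
  next
    \<comment> \<open>This includes \<open>j = 0\<close> with 0 in \<open>A\<close>: the left side
      is excluded by \<open>A - {0}\<close>, and the right side vanishes because
      \<open>\<rho>\<close> does not charge 0.\<close>
    case False
    then have e: "{\<omega> \<in> space ?M. X t \<omega> = j \<and> X t \<omega> \<in> A - {0}} = {}"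
      and "{i. i = j \<and> i \<in> A} \<subseteq> {0}" by auto
    then have "measure_pmf.prob \<rho> {i. i = j \<and> i \<in> A} \<le> measure_pmf.prob \<rho> {0}"
      by (intro measure_pmf.finite_measure_mono) auto
    also have "\<dots> = 0" by (simp add: measure_pmf_single pmf_\<rho>)
    finally show ?thesis unfolding e by (simp add: measure_le_0_iff)
  qed
  moreover have "(\<lambda>j. exp (- (a * t)) * measure_pmf.prob \<rho> {i. i = j \<and> i \<in> A})
      sums (exp (- (a * t)) * measure_pmf.prob \<rho> A)"
    using sums_mult[OF partition_sums[of "measure_pmf \<rho>" "\<lambda>i. i" "\<lambda>i. i \<in> A"]]
    by (simp add: measure_pmf.finite_measure_axioms)
  ultimately have "measure ?M {\<omega> \<in> space ?M. X t \<omega> \<in> A - {0}} = exp (- (a * t)) * measure_pmf.prob \<rho> A"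
    using sums_unique2 by simp
  moreover have "(\<Sum>i. pmf \<rho> i * (1 - transition i 0 t)) = exp (- (a * t))"
    using r_survival[OF t] r_sums_1 by (simp add: pmf_\<rho> sums_iff)
  ultimately show "conditional_law P X \<rho> t A = measure_pmf.prob \<rho> A"
    by (simp add: conditional_law_eq[OF t] space_law)
qed

lemma domain_of_attraction_\<rho>:
  assumes "\<mu> \<in> M1" "summable (\<lambda>i. pmf \<mu> i * q i)"
  shows "\<mu> \<in> domain_of_attraction P X \<rho>"
  using assms attracted by (simp add: domain_of_attraction_def pmf_\<rho>)

text \<open>Against a Dirac mass the integral of \<open>q\<close> has a single term, so all Dirac
  masses are attracted to \<open>\<rho>\<close>; uniqueness then evaluates the definite
  description.\<close>

lemma minimal_qsd_eq: "minimal_qsd P X = \<rho>"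
proof -
  have "return_pmf x \<in> domain_of_attraction P X \<rho>" if "1 \<le> x" for x
  proof (rule domain_of_attraction_\<rho>)
    show "return_pmf x \<in> M1" using that by (simp add: M1_def)
    show "summable (\<lambda>i. pmf (return_pmf x) i * q i)"
      by (rule summable_finite[of "{x}"]) auto
  qed
  then have "is_minimal_qsd P X \<rho>"
    by (simp add: is_minimal_qsd_def quasi_stationary_\<rho>)
  then show ?thesis
    unfolding minimal_qsd_def by (intro the_equality minimal_qsd_unique)
qed

lemma summable_q_lyapunov:
  assumes lam: "a < lam" and \<phi>: "\<And>i. 0 \<le> \<phi> i" "filterlim \<phi> at_top sequentially"
    and gen: "\<And>i. 1 \<le> i \<Longrightarrow> bd_generator b d \<phi> i \<le> - lam * \<phi> i + C"
    and \<mu>: "summable (\<lambda>i. pmf \<mu> i * \<phi> i)"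
  shows "summable (\<lambda>i. pmf \<mu> i * q i)"
proof -
  \<comment> \<open>Once \<open>\<phi> i\<close> reaches \<open>C / (lam - a)\<close>, the gap
    between \<open>lam\<close> and \<open>a\<close> absorbs \<open>C\<close>. The maximum with 1
    makes \<open>\<phi> n\<close> positive, as needed for the division.\<close>
  obtain N where N: "\<And>i. N \<le> i \<Longrightarrow> max 1 (C / (lam - a)) \<le> \<phi> i"
    using \<phi>(2) unfolding filterlim_at_top eventually_sequentially by blast
  define n where "n = Suc N"
  have n: "1 \<le> n" "0 < \<phi> n" using N[of n] by (auto simp: n_def)
  have super: "bd_generator b d \<phi> i \<le> - a * \<phi> i" if "n < i" for i
  proof -
    have "C / (lam - a) \<le> \<phi> i" using N[of i] that by (simp add: n_def)
    then have "C \<le> (lam - a) * \<phi> i" using lam by (simp add: field_simps)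
    then show ?thesis using gen[of i] that by (simp add: algebra_simps)
  qed
  have le: "q i \<le> \<phi> i / (\<phi> n * (c * (w n * q n)))" if "n \<le> i" for i
    using \<phi>(1) n super that by (rule q_le_lyapunov)
  define K where "K = 1 / (\<phi> n * (c * (w n * q n)))"
  have "norm (pmf \<mu> i * q i) \<le> K * (pmf \<mu> i * \<phi> i)" if "n \<le> i" for i
    using mult_left_mono[OF le[OF that] pmf_nonneg[of \<mu> i]]
    by (simp add: K_def q_nonneg abs_mult mult.commute)
  then show ?thesis by (rule summable_comparison_test'[OF summable_mult[OF \<mu>]])
qed

end

theorem theorem2p4:
  fixes b d :: "nat \<Rightarrow> real"
    and P :: "nat \<Rightarrow> 'w measure"
    and X :: "real \<Rightarrow> 'w \<Rightarrow> nat"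
  assumes "birth_death_process b d P X"
    and "b 0 = 0" and "d 0 = 0"
    and "\<forall>i\<ge>1. 0 < b i \<and> 0 < d i"
    and "filterlim (\<lambda>N. \<Sum>n=1..N. (\<Prod>k=1..n. d k) / (\<Prod>k=1..n. b k)) at_top sequentially"
    and "xi1_positive_recurrent b d P X"
  shows "{\<mu> \<in> M1. (\<lambda>i. pmf \<mu> i * Q b d i (xi1 b d)) summable_on {1..}}
           \<subseteq> domain_of_attraction P X (minimal_qsd P X)
       \<and> (\<forall>(C::real) (lam1::real) (\<phi> :: nat \<Rightarrow> real).
            0 < C \<longrightarrow> xi1 b d < lam1 \<longrightarrow> (\<forall>i. 0 \<le> \<phi> i) \<longrightarrow> filterlim \<phi> at_top sequentially \<longrightarrow>
            (\<forall>i\<ge>1. bd_generator b d \<phi> i \<le> - lam1 * \<phi> i + C) \<longrightarrow>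
            {\<mu> \<in> M1. (\<lambda>i. pmf \<mu> i * \<phi> i) summable_on {1..}}
              \<subseteq> domain_of_attraction P X (minimal_qsd P X))"
proof -
  interpret birth_death_process b d P X by fact
  have pos: "0 < b i \<and> 0 < d i" if "1 \<le> i" for i using assms(4) that by blast
  interpret birth_death_semigroup b d transition
    by (rule transition_semigroup) (use assms pos in auto)
  have xi1: "0 \<le> xi1 b d \<and> (\<forall>x. x \<le> xi1 b d \<longleftrightarrow> (\<forall>n\<ge>1. 0 < Q b d n x))"
    unfolding xi1_def by (rule theI'[OF xi1_ex1[OF pos]])
  have "birth_death_positive_recurrent b d transition (xi1 b d)"
  proof
    \<comment> \<open>The characterisation of \<open>xi1 b d\<close> is used at the point
      \<open>xi1 b d\<close> itself.\<close>
    show "0 < Q b d n (xi1 b d)" if "1 \<le> n" for n using xi1 that by blast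
  qed (use assms(6) in \<open>auto simp: xi1_positive_recurrent_def transition_def\<close>)
  then interpret positive_recurrent_process b d P X "xi1 b d"
    by (intro positive_recurrent_process.intro positive_recurrent_process_axioms.intro
        absorbed_birth_death_process.intro absorbed_birth_death_process_axioms.intro
        birth_death_process_axioms birth_death_semigroup_axioms)
  have "\<mu> \<in> domain_of_attraction P X (minimal_qsd P X)"
    if "\<mu> \<in> M1" "(\<lambda>i. pmf \<mu> i * q i) summable_on {1..}" for \<mu>
    unfolding minimal_qsd_eq using that by (intro domain_of_attraction_\<rho> summable_M1_weighted)
  moreover have "\<mu> \<in> domain_of_attraction P X (minimal_qsd P X)"
    if "xi1 b d < lam1" "\<forall>i. 0 \<le> \<phi> i" "filterlim \<phi> at_top sequentially"
      "\<forall>i\<ge>1. bd_generator b d \<phi> i \<le> - lam1 * \<phi> i + C"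
      "\<mu> \<in> M1" "(\<lambda>i. pmf \<mu> i * \<phi> i) summable_on {1..}" for C lam1 \<phi> \<mu>
    unfolding minimal_qsd_eq using that summable_M1_weighted[OF that(5,6)]
    by (intro domain_of_attraction_\<rho> summable_q_lyapunov[of lam1 \<phi> C \<mu>]) auto
  ultimately show ?thesis by blast
qed

end
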